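(* Let $H\in\Theta$, $X\in\Gamma$, and let $s:W(X^0)\to W(X)$ be a special homomorphism. Then for every $X$-type $T$ over $H$ we have $T^{L_0}_H=(s_*T)^L_H$, where $s_*T=\{s_*u:u\in T\}$.
   Context: Fix a variety $\Theta$, an infinite set of variables $X^0$, let $\Gamma$ be the set of finite subsets of $X^0$ and $\Gamma^*=\Gamma\cup\{X^0\}$; $W(X)$ is the free algebra of $\Theta$ over $X$. For $H\in\Theta$ and $X\in\Gamma^*$, $\mathrm{Hal}^X_\Theta(H)$ is the Boolean algebra of subsets of $\mathrm{Hom}(W(X),H)$ with quantifiers ($\mu\in\exists xA$ iff some $\nu\in A$ agrees with $\mu$ off $x$), equalities $[w\equiv w']_H=\{\mu:\mu(w)=\mu(w')\}$ and maps $s_*(A)=\{\mu:\mu\circ s\in A\}$ for homomorphisms $s:W(X)\to W(Y)$. The multi-sorted algebra of formulas $\Phi=(\Phi(X),X\in\Gamma^* )$ is the free Halmos algebra over the sets of formal equalities $w\equiv w'$, $w,w'\in W(X)$ (with operations $s_*:\Phi(X)\to\Phi(Y)$ for homomorphisms $s:W(X)\to W(Y)$); $\mathrm{Val}^X_H$ are the components of the unique homomorphism $\Phi\to\mathrm{Hal}_\Theta(H)$ sending $w\equiv w'$ to $[w\equiv w']_H$. A point $\mu$ satisfies $u$ iff $\mu\in\mathrm{Val}^X_H(u)$; $\mathrm{LKer}(\mu)$ is the set of formulas satisfied by $\mu$; for $T'\subseteq\Phi(X)$, $T'^L_H=\{\mu\in\mathrm{Hom}(W(X),H):T'\subseteq\mathrm{LKer}(\mu)\}$.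 $\Phi(X^0)$ is the Lindenbaum–Tarski algebra of first-order formulas with equalities in the signature of $\Theta$ over variables $X^0$. For $X=\{x_1,\dots,x_n\}$, $u\in\Phi(X^0)$ is $X$-special if its free variables lie in $X$ and its bound variables lie in $X^0\setminus X$. An $X$-type over $H$ is a set of $X$-special formulas consistent with the elementary theory of $H$. For $\mu:W(X)\to H$, $\mathrm{Tp}^H(\mu)$ is the set of $X$-special $u$ such that every $\eta:W(X^0)\to H$ with $\eta(x_i)=\mu(x_i)$ for all $i$ satisfies $u$. For an $X$-type $T$, $T^{L_0}_H=\{\mu\in\mathrm{Hom}(W(X),H):T\subseteq\mathrm{Tp}^H(\mu)\}$. A homomorphism $s:W(X^0)\to W(X)$ is special if $s(x)=x$ for all $x\in X$. *)

theory Defs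
  imports "HOL-Library.FuncSet"
begin

section \<open>Varieties and their free algebras\<close>

datatype ('f, tvars: 'v) tm = V 'v | Op 'f "('f, 'v) tm list"

text \<open>A signature is a set of pairs (operation symbol, arity).\<close>

type_synonym 'f sg = "('f \<times> nat) set"

inductive_set terms :: "'f sg \<Rightarrow> 'v set \<Rightarrow> ('f, 'v) tm set" for S :: "'f sg" and X :: "'v set" where
  Var: "x \<in> X \<Longrightarrow> V x \<in> terms S X"
| App: "(f, length ts) \<in> S \<Longrightarrow> (\<And>t. t \<in> set ts \<Longrightarrow> t \<in> terms S X) \<Longrightarrow> Op f ts \<in> terms S X"

record ('f, 'a) alg =
  univ :: "'a set"
  opn :: "'f \<Rightarrow> 'a list \<Rightarrow> 'a"

primrec ev :: "('f, 'a) alg \<Rightarrow> ('v \<Rightarrow> 'a) \<Rightarrow> ('f, 'v) tm \<Rightarrow> 'a" where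
  "ev A \<alpha> (V x) = \<alpha> x"
| "ev A \<alpha> (Op f ts) = opn A f (map (ev A \<alpha>) ts)"

definition term_alg :: "'f sg \<Rightarrow> 'v set \<Rightarrow> ('f, ('f, 'v) tm) alg" where
  "term_alg S X = \<lparr>univ = terms S X, opn = Op\<rparr>"

text \<open>A variety is given by its signature and a set of identities, written in variables from
  \<^typ>\<open>nat\<close>. Algebras are allowed to be empty.\<close>

record 'f variety =
  sgn :: "'f sg"
  ids :: "(('f, nat) tm \<times> ('f, nat) tm) set"

definition is_variety :: "'f variety \<Rightarrow> bool" where
  "is_variety \<Theta> \<longleftrightarrow> ids \<Theta> \<subseteq> terms (sgn \<Theta>) UNIV \<times> terms (sgn \<Theta>) UNIV"

definition is_alg :: "'f sg \<Rightarrow> ('f, 'a) alg \<Rightarrow> bool" where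
  "is_alg S A \<longleftrightarrow> (\<forall>f as. (f, length as) \<in> S \<longrightarrow> set as \<subseteq> univ A \<longrightarrow> opn A f as \<in> univ A)"

definition in_variety :: "'f variety \<Rightarrow> ('f, 'a) alg \<Rightarrow> bool" where
  "in_variety \<Theta> A \<longleftrightarrow> is_alg (sgn \<Theta>) A \<and>
     (\<forall>(l, r) \<in> ids \<Theta>. \<forall>\<alpha>. range \<alpha> \<subseteq> univ A \<longrightarrow> ev A \<alpha> l = ev A \<alpha> r)"

text \<open>Homomorphisms are extensional functions on the carrier, so that equality of homomorphisms
  is equality in HOL.\<close>

definition Hom :: "'f variety \<Rightarrow> ('f, 'a) alg \<Rightarrow> ('f, 'b) alg \<Rightarrow> ('a \<Rightarrow> 'b) set" where
  "Hom \<Theta> A B = {h \<in> univ A \<rightarrow>\<^sub>E univ B.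
     \<forall>f as. (f, length as) \<in> sgn \<Theta> \<longrightarrow> set as \<subseteq> univ A \<longrightarrow> h (opn A f as) = opn B f (map h as)}"

text \<open>\<open>W \<Theta> X\<close> is the term algebra over \<open>X\<close> modulo the least congruence containing all
  instances of the identities.\<close>

inductive teq :: "'f variety \<Rightarrow> 'v set \<Rightarrow> ('f, 'v) tm \<Rightarrow> ('f, 'v) tm \<Rightarrow> bool"
  for \<Theta> :: "'f variety" and X :: "'v set" where
  refl: "t \<in> terms (sgn \<Theta>) X \<Longrightarrow> teq \<Theta> X t t"
| sym: "teq \<Theta> X t u \<Longrightarrow> teq \<Theta> X u t"
| trans: "teq \<Theta> X t u \<Longrightarrow> teq \<Theta> X u v \<Longrightarrow> teq \<Theta> X t v"
| cong: "(f, length ts) \<in> sgn \<Theta> \<Longrightarrow> list_all2 (teq \<Theta> X) ts us \<Longrightarrow> teq \<Theta> X (Op f ts) (Op f us)"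
| inst: "(l, r) \<in> ids \<Theta> \<Longrightarrow> range \<sigma> \<subseteq> terms (sgn \<Theta>) X \<Longrightarrow>
     teq \<Theta> X (ev (term_alg (sgn \<Theta>) X) \<sigma> l) (ev (term_alg (sgn \<Theta>) X) \<sigma> r)"

type_synonym ('f, 'v) wd = "('f, 'v) tm set"

definition cls :: "'f variety \<Rightarrow> 'v set \<Rightarrow> ('f, 'v) tm \<Rightarrow> ('f, 'v) wd" where
  "cls \<Theta> X t = {u. teq \<Theta> X t u}"

definition W :: "'f variety \<Rightarrow> 'v set \<Rightarrow> ('f, ('f, 'v) wd) alg" where
  "W \<Theta> X = \<lparr>univ = cls \<Theta> X ` terms (sgn \<Theta>) X,
     opn = \<lambda>f ws. {u. \<exists>ts. list_all2 (\<in>) ts ws \<and> teq \<Theta> X (Op f ts) u}\<rparr>"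

abbreviation var :: "'f variety \<Rightarrow> 'v set \<Rightarrow> 'v \<Rightarrow> ('f, 'v) wd" where
  "var \<Theta> X x \<equiv> cls \<Theta> X (V x)"

text \<open>The variable \<open>y\<close> does not occur in (a shortest expression of) the element \<open>w\<close>.\<close>

definition avoids :: "'v \<Rightarrow> ('f, 'v) wd \<Rightarrow> bool" where
  "avoids y w \<longleftrightarrow> (\<exists>t\<in>w. y \<notin> tvars t)"


section \<open>Multi-sorted Halmos algebras\<close>

text \<open>The set of sorts \<open>\<Gamma>\<^sup>*\<close>.\<close>

definition sorts :: "'v set \<Rightarrow> 'v set set" where
  "sorts X0 = insert X0 {X. X \<subseteq> X0 \<and> finite X}"

text \<open>The map \<open>s\<^sub>*\<close> for \<open>s : W(X) \<rightarrow> W(Y)\<close> is \<open>sub L X Y s\<close>.\<close>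

record ('f, 'v, 'l) halmos =
  dom :: "'v set \<Rightarrow> 'l set"
  zer :: "'v set \<Rightarrow> 'l"
  one :: "'v set \<Rightarrow> 'l"
  neg :: "'v set \<Rightarrow> 'l \<Rightarrow> 'l"
  meet :: "'v set \<Rightarrow> 'l \<Rightarrow> 'l \<Rightarrow> 'l"
  join :: "'v set \<Rightarrow> 'l \<Rightarrow> 'l \<Rightarrow> 'l"
  ex :: "'v set \<Rightarrow> 'v \<Rightarrow> 'l \<Rightarrow> 'l"
  eqn :: "'v set \<Rightarrow> ('f, 'v) wd \<Rightarrow> ('f, 'v) wd \<Rightarrow> 'l"
  sub :: "'v set \<Rightarrow> 'v set \<Rightarrow> (('f, 'v) wd \<Rightarrow> ('f, 'v) wd) \<Rightarrow> 'l \<Rightarrow> 'l"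

definition leq :: "('f, 'v, 'l) halmos \<Rightarrow> 'v set \<Rightarrow> 'l \<Rightarrow> 'l \<Rightarrow> bool" where
  "leq L X a b \<longleftrightarrow> meet L X a b = a"

definition meets :: "('f, 'v, 'l) halmos \<Rightarrow> 'v set \<Rightarrow> 'l list \<Rightarrow> 'l" where
  "meets L X as = foldr (meet L X) as (one L X)"

locale halmos_sig =
  fixes \<Theta> :: "'f variety" and X0 :: "'v set" and L :: "('f, 'v, 'l) halmos"
  assumes zer_closed: "X \<in> sorts X0 \<Longrightarrow> zer L X \<in> dom L X"
    and one_closed: "X \<in> sorts X0 \<Longrightarrow> one L X \<in> dom L X"
    and neg_closed: "X \<in> sorts X0 \<Longrightarrow> a \<in> dom L X \<Longrightarrow> neg L X a \<in> dom L X"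
    and meet_closed: "X \<in> sorts X0 \<Longrightarrow> a \<in> dom L X \<Longrightarrow> b \<in> dom L X \<Longrightarrow> meet L X a b \<in> dom L X"
    and join_closed: "X \<in> sorts X0 \<Longrightarrow> a \<in> dom L X \<Longrightarrow> b \<in> dom L X \<Longrightarrow> join L X a b \<in> dom L X"
    and ex_closed: "X \<in> sorts X0 \<Longrightarrow> x \<in> X \<Longrightarrow> a \<in> dom L X \<Longrightarrow> ex L X x a \<in> dom L X"
    and eqn_closed: "X \<in> sorts X0 \<Longrightarrow> w \<in> univ (W \<Theta> X) \<Longrightarrow> w' \<in> univ (W \<Theta> X) \<Longrightarrow>
      eqn L X w w' \<in> dom L X"
    and sub_closed: "X \<in> sorts X0 \<Longrightarrow> Y \<in> sorts X0 \<Longrightarrow> s \<in> Hom \<Theta> (W \<Theta> X) (W \<Theta> Y) \<Longrightarrow>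
      a \<in> dom L X \<Longrightarrow> sub L X Y s a \<in> dom L Y"

locale halmos_algebra = halmos_sig +
  \<comment> \<open>Boolean algebra (Huntington's axioms)\<close>
  assumes meet_comm: "X \<in> sorts X0 \<Longrightarrow> a \<in> dom L X \<Longrightarrow> b \<in> dom L X \<Longrightarrow>
      meet L X a b = meet L X b a"
    and join_comm: "X \<in> sorts X0 \<Longrightarrow> a \<in> dom L X \<Longrightarrow> b \<in> dom L X \<Longrightarrow>
      join L X a b = join L X b a"
    and meet_join_distrib: "X \<in> sorts X0 \<Longrightarrow> a \<in> dom L X \<Longrightarrow> b \<in> dom L X \<Longrightarrow> c \<in> dom L X \<Longrightarrow>
      meet L X a (join L X b c) = join L X (meet L X a b) (meet L X a c)"
    and join_meet_distrib: "X \<in> sorts X0 \<Longrightarrow> a \<in> dom L X \<Longrightarrow> b \<in> dom L X \<Longrightarrow> c \<in> dom L X \<Longrightarrow>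
      join L X a (meet L X b c) = meet L X (join L X a b) (join L X a c)"
    and meet_one: "X \<in> sorts X0 \<Longrightarrow> a \<in> dom L X \<Longrightarrow> meet L X a (one L X) = a"
    and join_zer: "X \<in> sorts X0 \<Longrightarrow> a \<in> dom L X \<Longrightarrow> join L X a (zer L X) = a"
    and meet_neg: "X \<in> sorts X0 \<Longrightarrow> a \<in> dom L X \<Longrightarrow> meet L X a (neg L X a) = zer L X"
    and join_neg: "X \<in> sorts X0 \<Longrightarrow> a \<in> dom L X \<Longrightarrow> join L X a (neg L X a) = one L X"
  \<comment> \<open>existential quantifiers\<close>
    and ex_zer: "X \<in> sorts X0 \<Longrightarrow> x \<in> X \<Longrightarrow> ex L X x (zer L X) = zer L X"
    and le_ex: "X \<in> sorts X0 \<Longrightarrow> x \<in> X \<Longrightarrow> a \<in> dom L X \<Longrightarrow> leq L X a (ex L X x a)"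
    and ex_meet: "X \<in> sorts X0 \<Longrightarrow> x \<in> X \<Longrightarrow> a \<in> dom L X \<Longrightarrow> b \<in> dom L X \<Longrightarrow>
      ex L X x (meet L X a (ex L X x b)) = meet L X (ex L X x a) (ex L X x b)"
    and ex_comm: "X \<in> sorts X0 \<Longrightarrow> x \<in> X \<Longrightarrow> y \<in> X \<Longrightarrow> a \<in> dom L X \<Longrightarrow>
      ex L X x (ex L X y a) = ex L X y (ex L X x a)"
  \<comment> \<open>equality is a congruence\<close>
    and eqn_refl: "X \<in> sorts X0 \<Longrightarrow> w \<in> univ (W \<Theta> X) \<Longrightarrow> eqn L X w w = one L X"
    and eqn_sym: "X \<in> sorts X0 \<Longrightarrow> w \<in> univ (W \<Theta> X) \<Longrightarrow> w' \<in> univ (W \<Theta> X) \<Longrightarrow>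
      eqn L X w w' = eqn L X w' w"
    and eqn_trans: "X \<in> sorts X0 \<Longrightarrow> w \<in> univ (W \<Theta> X) \<Longrightarrow> w' \<in> univ (W \<Theta> X) \<Longrightarrow>
      w'' \<in> univ (W \<Theta> X) \<Longrightarrow> leq L X (meet L X (eqn L X w w') (eqn L X w' w'')) (eqn L X w w'')"
    and eqn_cong: "X \<in> sorts X0 \<Longrightarrow> (f, length ws) \<in> sgn \<Theta> \<Longrightarrow> length ws' = length ws \<Longrightarrow>
      set ws \<subseteq> univ (W \<Theta> X) \<Longrightarrow> set ws' \<subseteq> univ (W \<Theta> X) \<Longrightarrow>
      leq L X (meets L X (map2 (eqn L X) ws ws'))
              (eqn L X (opn (W \<Theta> X) f ws) (opn (W \<Theta> X) f ws'))"
  \<comment> \<open>the maps \<open>s\<^sub>*\<close> are Boolean homomorphisms, functorial in \<open>s\<close>\<close>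
    and sub_zer: "X \<in> sorts X0 \<Longrightarrow> Y \<in> sorts X0 \<Longrightarrow> s \<in> Hom \<Theta> (W \<Theta> X) (W \<Theta> Y) \<Longrightarrow>
      sub L X Y s (zer L X) = zer L Y"
    and sub_one: "X \<in> sorts X0 \<Longrightarrow> Y \<in> sorts X0 \<Longrightarrow> s \<in> Hom \<Theta> (W \<Theta> X) (W \<Theta> Y) \<Longrightarrow>
      sub L X Y s (one L X) = one L Y"
    and sub_neg: "X \<in> sorts X0 \<Longrightarrow> Y \<in> sorts X0 \<Longrightarrow> s \<in> Hom \<Theta> (W \<Theta> X) (W \<Theta> Y) \<Longrightarrow>
      a \<in> dom L X \<Longrightarrow> sub L X Y s (neg L X a) = neg L Y (sub L X Y s a)"
    and sub_meet: "X \<in> sorts X0 \<Longrightarrow> Y \<in> sorts X0 \<Longrightarrow> s \<in> Hom \<Theta> (W \<Theta> X) (W \<Theta> Y) \<Longrightarrow>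
      a \<in> dom L X \<Longrightarrow> b \<in> dom L X \<Longrightarrow>
      sub L X Y s (meet L X a b) = meet L Y (sub L X Y s a) (sub L X Y s b)"
    and sub_join: "X \<in> sorts X0 \<Longrightarrow> Y \<in> sorts X0 \<Longrightarrow> s \<in> Hom \<Theta> (W \<Theta> X) (W \<Theta> Y) \<Longrightarrow>
      a \<in> dom L X \<Longrightarrow> b \<in> dom L X \<Longrightarrow>
      sub L X Y s (join L X a b) = join L Y (sub L X Y s a) (sub L X Y s b)"
    and sub_id: "X \<in> sorts X0 \<Longrightarrow> a \<in> dom L X \<Longrightarrow> sub L X X (\<lambda>w\<in>univ (W \<Theta> X). w) a = a"
    and sub_comp: "X \<in> sorts X0 \<Longrightarrow> Y \<in> sorts X0 \<Longrightarrow> Z \<in> sorts X0 \<Longrightarrow>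
      s \<in> Hom \<Theta> (W \<Theta> X) (W \<Theta> Y) \<Longrightarrow> s' \<in> Hom \<Theta> (W \<Theta> Y) (W \<Theta> Z) \<Longrightarrow> a \<in> dom L X \<Longrightarrow>
      sub L Y Z s' (sub L X Y s a) = sub L X Z (compose (univ (W \<Theta> X)) s' s) a"
  \<comment> \<open>the maps \<open>s\<^sub>*\<close> and quantifiers\<close>
    and sub_ex_agree: "X \<in> sorts X0 \<Longrightarrow> Y \<in> sorts X0 \<Longrightarrow> s \<in> Hom \<Theta> (W \<Theta> X) (W \<Theta> Y) \<Longrightarrow>
      s' \<in> Hom \<Theta> (W \<Theta> X) (W \<Theta> Y) \<Longrightarrow> x \<in> X \<Longrightarrow>
      (\<And>z. z \<in> X \<Longrightarrow> z \<noteq> x \<Longrightarrow> s (var \<Theta> X z) = s' (var \<Theta> X z)) \<Longrightarrow> a \<in> dom L X \<Longrightarrow>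
      sub L X Y s (ex L X x a) = sub L X Y s' (ex L X x a)"
    and sub_ex: "X \<in> sorts X0 \<Longrightarrow> Y \<in> sorts X0 \<Longrightarrow> s \<in> Hom \<Theta> (W \<Theta> X) (W \<Theta> Y) \<Longrightarrow>
      x \<in> X \<Longrightarrow> y \<in> Y \<Longrightarrow> s (var \<Theta> X x) = var \<Theta> Y y \<Longrightarrow>
      (\<And>z. z \<in> X \<Longrightarrow> z \<noteq> x \<Longrightarrow> avoids y (s (var \<Theta> X z))) \<Longrightarrow> a \<in> dom L X \<Longrightarrow>
      sub L X Y s (ex L X x a) = ex L Y y (sub L X Y s a)"
  \<comment> \<open>the maps \<open>s\<^sub>*\<close> and equalities; below \<open>s\<close> and \<open>s'\<close> send \<open>x\<close> to \<open>w\<close> and \<open>w'\<close> and fix all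
      other variables\<close>
    and sub_eqn: "X \<in> sorts X0 \<Longrightarrow> Y \<in> sorts X0 \<Longrightarrow> s \<in> Hom \<Theta> (W \<Theta> X) (W \<Theta> Y) \<Longrightarrow>
      w \<in> univ (W \<Theta> X) \<Longrightarrow> w' \<in> univ (W \<Theta> X) \<Longrightarrow>
      sub L X Y s (eqn L X w w') = eqn L Y (s w) (s w')"
    and sub_replace: "X \<in> sorts X0 \<Longrightarrow> x \<in> X \<Longrightarrow> w \<in> univ (W \<Theta> X) \<Longrightarrow> w' \<in> univ (W \<Theta> X) \<Longrightarrow>
      s \<in> Hom \<Theta> (W \<Theta> X) (W \<Theta> X) \<Longrightarrow> s' \<in> Hom \<Theta> (W \<Theta> X) (W \<Theta> X) \<Longrightarrow>
      s (var \<Theta> X x) = w \<Longrightarrow> s' (var \<Theta> X x) = w' \<Longrightarrow>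
      (\<And>z. z \<in> X \<Longrightarrow> z \<noteq> x \<Longrightarrow> s (var \<Theta> X z) = var \<Theta> X z \<and> s' (var \<Theta> X z) = var \<Theta> X z) \<Longrightarrow>
      a \<in> dom L X \<Longrightarrow>
      leq L X (meet L X (sub L X X s a) (eqn L X w w')) (sub L X X s' a)"

text \<open>The equalities \<open>w \<equiv> w'\<close> are nullary operations of the signature, so homomorphisms send
  equalities to equalities.\<close>

definition halmos_hom :: "'f variety \<Rightarrow> 'v set \<Rightarrow> ('f, 'v, 'l) halmos \<Rightarrow> ('f, 'v, 'm) halmos \<Rightarrow>
    ('v set \<Rightarrow> 'l \<Rightarrow> 'm) \<Rightarrow> bool" where
  "halmos_hom \<Theta> X0 L M h \<longleftrightarrow> h \<in> (\<Pi>\<^sub>E X\<in>sorts X0. dom L X \<rightarrow>\<^sub>E dom M X) \<and>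
   (\<forall>X\<in>sorts X0. h X (zer L X) = zer M X \<and> h X (one L X) = one M X \<and>
     (\<forall>a\<in>dom L X. h X (neg L X a) = neg M X (h X a)) \<and>
     (\<forall>a\<in>dom L X. \<forall>b\<in>dom L X. h X (meet L X a b) = meet M X (h X a) (h X b)) \<and>
     (\<forall>a\<in>dom L X. \<forall>b\<in>dom L X. h X (join L X a b) = join M X (h X a) (h X b)) \<and>
     (\<forall>x\<in>X. \<forall>a\<in>dom L X. h X (ex L X x a) = ex M X x (h X a)) \<and>
     (\<forall>w\<in>univ (W \<Theta> X). \<forall>w'\<in>univ (W \<Theta> X). h X (eqn L X w w') = eqn M X w w') \<and>
     (\<forall>Y\<in>sorts X0. \<forall>s\<in>Hom \<Theta> (W \<Theta> X) (W \<Theta> Y). \<forall>a\<in>dom L X.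
        h Y (sub L X Y s a) = sub M X Y s (h X a)))"

definition Hal :: "'f variety \<Rightarrow> ('f, 'h) alg \<Rightarrow> ('f, 'v, (('f, 'v) wd \<Rightarrow> 'h) set) halmos" where
  "Hal \<Theta> H = \<lparr>
     dom = \<lambda>X. Pow (Hom \<Theta> (W \<Theta> X) H),
     zer = \<lambda>X. {},
     one = \<lambda>X. Hom \<Theta> (W \<Theta> X) H,
     neg = \<lambda>X A. Hom \<Theta> (W \<Theta> X) H - A,
     meet = \<lambda>X A B. A \<inter> B,
     join = \<lambda>X A B. A \<union> B,
     ex = \<lambda>X x A. {\<mu> \<in> Hom \<Theta> (W \<Theta> X) H.
            \<exists>\<nu>\<in>A. \<forall>y\<in>X. y \<noteq> x \<longrightarrow> \<nu> (var \<Theta> X y) = \<mu> (var \<Theta> X y)},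
     eqn = \<lambda>X w w'. {\<mu> \<in> Hom \<Theta> (W \<Theta> X) H. \<mu> w = \<mu> w'},
     sub = \<lambda>X Y s A. {\<mu> \<in> Hom \<Theta> (W \<Theta> Y) H. compose (univ (W \<Theta> X)) \<mu> s \<in> A}\<rparr>"


section \<open>The algebra of formulas\<close>

text \<open>Words in the signature of Halmos algebras. In \<open>Sub X s \<phi>\<close> the sort \<open>X\<close> is that of \<open>\<phi>\<close>.\<close>

datatype ('f, 'v) fm =
    Eqn "('f, 'v) wd" "('f, 'v) wd"
  | Zer
  | One
  | Neg "('f, 'v) fm"
  | Meet "('f, 'v) fm" "('f, 'v) fm"
  | Join "('f, 'v) fm" "('f, 'v) fm"
  | Ex 'v "('f, 'v) fm"
  | Sub "'v set" "('f, 'v) wd \<Rightarrow> ('f, 'v) wd" "('f, 'v) fm"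

inductive wf_fm :: "'f variety \<Rightarrow> 'v set \<Rightarrow> 'v set \<Rightarrow> ('f, 'v) fm \<Rightarrow> bool"
  for \<Theta> :: "'f variety" and X0 :: "'v set" where
  "w \<in> univ (W \<Theta> X) \<Longrightarrow> w' \<in> univ (W \<Theta> X) \<Longrightarrow> wf_fm \<Theta> X0 X (Eqn w w')"
| "wf_fm \<Theta> X0 X Zer"
| "wf_fm \<Theta> X0 X One"
| "wf_fm \<Theta> X0 X \<phi> \<Longrightarrow> wf_fm \<Theta> X0 X (Neg \<phi>)"
| "wf_fm \<Theta> X0 X \<phi> \<Longrightarrow> wf_fm \<Theta> X0 X \<psi> \<Longrightarrow> wf_fm \<Theta> X0 X (Meet \<phi> \<psi>)"
| "wf_fm \<Theta> X0 X \<phi> \<Longrightarrow> wf_fm \<Theta> X0 X \<psi> \<Longrightarrow> wf_fm \<Theta> X0 X (Join \<phi> \<psi>)"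
| "x \<in> X \<Longrightarrow> wf_fm \<Theta> X0 X \<phi> \<Longrightarrow> wf_fm \<Theta> X0 X (Ex x \<phi>)"
| "X \<in> sorts X0 \<Longrightarrow> s \<in> Hom \<Theta> (W \<Theta> X) (W \<Theta> Y) \<Longrightarrow> wf_fm \<Theta> X0 X \<phi> \<Longrightarrow> wf_fm \<Theta> X0 Y (Sub X s \<phi>)"

definition word_alg :: "'f variety \<Rightarrow> 'v set \<Rightarrow> ('f, 'v, ('f, 'v) fm) halmos" where
  "word_alg \<Theta> X0 = \<lparr>dom = \<lambda>X. {\<phi>. wf_fm \<Theta> X0 X \<phi>}, zer = \<lambda>X. Zer, one = \<lambda>X. One,
     neg = \<lambda>X. Neg, meet = \<lambda>X. Meet, join = \<lambda>X. Join, ex = \<lambda>X. Ex, eqn = \<lambda>X. Eqn,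
     sub = \<lambda>X Y s. Sub X s\<rparr>"

definition halmos_cong :: "'f variety \<Rightarrow> 'v set \<Rightarrow> ('f, 'v, 'l) halmos \<Rightarrow> ('v set \<Rightarrow> ('l \<times> 'l) set) \<Rightarrow> bool"
where
  "halmos_cong \<Theta> X0 L R \<longleftrightarrow> (\<forall>X\<in>sorts X0. equiv (dom L X) (R X) \<and>
     (\<forall>(a, a')\<in>R X. (neg L X a, neg L X a') \<in> R X) \<and>
     (\<forall>(a, a')\<in>R X. \<forall>(b, b')\<in>R X. (meet L X a b, meet L X a' b') \<in> R X) \<and>
     (\<forall>(a, a')\<in>R X. \<forall>(b, b')\<in>R X. (join L X a b, join L X a' b') \<in> R X) \<and>
     (\<forall>x\<in>X. \<forall>(a, a')\<in>R X. (ex L X x a, ex L X x a') \<in> R X) \<and>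
     (\<forall>Y\<in>sorts X0. \<forall>s\<in>Hom \<Theta> (W \<Theta> X) (W \<Theta> Y). \<forall>(a, a')\<in>R X.
        (sub L X Y s a, sub L X Y s a') \<in> R Y))"

definition quot :: "('f, 'v, 'l) halmos \<Rightarrow> ('v set \<Rightarrow> ('l \<times> 'l) set) \<Rightarrow> ('f, 'v, 'l set) halmos" where
  "quot L R = \<lparr>
     dom = \<lambda>X. dom L X // R X,
     zer = \<lambda>X. R X `` {zer L X},
     one = \<lambda>X. R X `` {one L X},
     neg = \<lambda>X A. \<Union>a\<in>A. R X `` {neg L X a},
     meet = \<lambda>X A B. \<Union>a\<in>A. \<Union>b\<in>B. R X `` {meet L X a b},
     join = \<lambda>X A B. \<Union>a\<in>A. \<Union>b\<in>B. R X `` {join L X a b},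
     ex = \<lambda>X x A. \<Union>a\<in>A. R X `` {ex L X x a},
     eqn = \<lambda>X w w'. R X `` {eqn L X w w'},
     sub = \<lambda>X Y s A. \<Union>a\<in>A. R Y `` {sub L X Y s a}\<rparr>"

text \<open>The free Halmos algebra \<open>\<Phi>\<close>: all words modulo the least congruence whose quotient is a
  Halmos algebra.\<close>

definition Phi_rel :: "'f variety \<Rightarrow> 'v set \<Rightarrow> 'v set \<Rightarrow> (('f, 'v) fm \<times> ('f, 'v) fm) set" where
  "Phi_rel \<Theta> X0 X = {(\<phi>, \<psi>). wf_fm \<Theta> X0 X \<phi> \<and> wf_fm \<Theta> X0 X \<psi> \<and>
     (\<forall>R. halmos_cong \<Theta> X0 (word_alg \<Theta> X0) R \<longrightarrow>
          halmos_algebra \<Theta> X0 (quot (word_alg \<Theta> X0) R) \<longrightarrow> (\<phi>, \<psi>) \<in> R X)}"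

definition Phi :: "'f variety \<Rightarrow> 'v set \<Rightarrow> ('f, 'v, ('f, 'v) fm set) halmos" where
  "Phi \<Theta> X0 = quot (word_alg \<Theta> X0) (Phi_rel \<Theta> X0)"

definition Val :: "'f variety \<Rightarrow> 'v set \<Rightarrow> ('f, 'h) alg \<Rightarrow> 'v set \<Rightarrow> ('f, 'v) fm set \<Rightarrow>
    (('f, 'v) wd \<Rightarrow> 'h) set" where
  "Val \<Theta> X0 H = (THE h. halmos_hom \<Theta> X0 (Phi \<Theta> X0) (Hal \<Theta> H) h)"

definition LKer :: "'f variety \<Rightarrow> 'v set \<Rightarrow> ('f, 'h) alg \<Rightarrow> 'v set \<Rightarrow> (('f, 'v) wd \<Rightarrow> 'h) \<Rightarrow>
    ('f, 'v) fm set set" where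
  "LKer \<Theta> X0 H X \<mu> = {u \<in> dom (Phi \<Theta> X0) X. \<mu> \<in> Val \<Theta> X0 H X u}"

definition L_closure :: "'f variety \<Rightarrow> 'v set \<Rightarrow> ('f, 'h) alg \<Rightarrow> 'v set \<Rightarrow> ('f, 'v) fm set set \<Rightarrow>
    (('f, 'v) wd \<Rightarrow> 'h) set" where
  "L_closure \<Theta> X0 H X T = {\<mu> \<in> Hom \<Theta> (W \<Theta> X) H. T \<subseteq> LKer \<Theta> X0 H X \<mu>}"


section \<open>First-order formulas and types\<close>

text \<open>Free and bound variables belong to first-order formulas, not to their classes in
  \<open>\<Phi>(X\<^sup>0)\<close>; \<open>fo_class\<close> maps a formula to its class.\<close>

datatype ('f, 'v) fo =
    FEq "('f, 'v) tm" "('f, 'v) tm"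
  | FFalse
  | FTrue
  | FNeg "('f, 'v) fo"
  | FAnd "('f, 'v) fo" "('f, 'v) fo"
  | FOr "('f, 'v) fo" "('f, 'v) fo"
  | FEx 'v "('f, 'v) fo"

primrec wf_fo :: "'f sg \<Rightarrow> 'v set \<Rightarrow> ('f, 'v) fo \<Rightarrow> bool" where
  "wf_fo S X (FEq t u) \<longleftrightarrow> t \<in> terms S X \<and> u \<in> terms S X"
| "wf_fo S X FFalse \<longleftrightarrow> True"
| "wf_fo S X FTrue \<longleftrightarrow> True"
| "wf_fo S X (FNeg p) \<longleftrightarrow> wf_fo S X p"
| "wf_fo S X (FAnd p q) \<longleftrightarrow> wf_fo S X p \<and> wf_fo S X q"
| "wf_fo S X (FOr p q) \<longleftrightarrow> wf_fo S X p \<and> wf_fo S X q"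
| "wf_fo S X (FEx x p) \<longleftrightarrow> x \<in> X \<and> wf_fo S X p"

primrec free_vars :: "('f, 'v) fo \<Rightarrow> 'v set" where
  "free_vars (FEq t u) = tvars t \<union> tvars u"
| "free_vars FFalse = {}"
| "free_vars FTrue = {}"
| "free_vars (FNeg p) = free_vars p"
| "free_vars (FAnd p q) = free_vars p \<union> free_vars q"
| "free_vars (FOr p q) = free_vars p \<union> free_vars q"
| "free_vars (FEx x p) = free_vars p - {x}"

primrec bound_vars :: "('f, 'v) fo \<Rightarrow> 'v set" where
  "bound_vars (FEq t u) = {}"
| "bound_vars FFalse = {}"
| "bound_vars FTrue = {}"
| "bound_vars (FNeg p) = bound_vars p"
| "bound_vars (FAnd p q) = bound_vars p \<union> bound_vars q"
| "bound_vars (FOr p q) = bound_vars p \<union> bound_vars q"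
| "bound_vars (FEx x p) = insert x (bound_vars p)"

primrec fo_word :: "'f variety \<Rightarrow> 'v set \<Rightarrow> ('f, 'v) fo \<Rightarrow> ('f, 'v) fm" where
  "fo_word \<Theta> X0 (FEq t u) = Eqn (cls \<Theta> X0 t) (cls \<Theta> X0 u)"
| "fo_word \<Theta> X0 FFalse = Zer"
| "fo_word \<Theta> X0 FTrue = One"
| "fo_word \<Theta> X0 (FNeg p) = Neg (fo_word \<Theta> X0 p)"
| "fo_word \<Theta> X0 (FAnd p q) = Meet (fo_word \<Theta> X0 p) (fo_word \<Theta> X0 q)"
| "fo_word \<Theta> X0 (FOr p q) = Join (fo_word \<Theta> X0 p) (fo_word \<Theta> X0 q)"
| "fo_word \<Theta> X0 (FEx x p) = Ex x (fo_word \<Theta> X0 p)"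

definition fo_class :: "'f variety \<Rightarrow> 'v set \<Rightarrow> ('f, 'v) fo \<Rightarrow> ('f, 'v) fm set" where
  "fo_class \<Theta> X0 p = Phi_rel \<Theta> X0 X0 `` {fo_word \<Theta> X0 p}"

definition X_special :: "'f variety \<Rightarrow> 'v set \<Rightarrow> 'v set \<Rightarrow> ('f, 'v) fm set \<Rightarrow> bool" where
  "X_special \<Theta> X0 X u \<longleftrightarrow> (\<exists>p. wf_fo (sgn \<Theta>) X0 p \<and> u = fo_class \<Theta> X0 p \<and>
     free_vars p \<subseteq> X \<and> bound_vars p \<subseteq> X0 - X)"

definition elementary_theory :: "'f variety \<Rightarrow> 'v set \<Rightarrow> ('f, 'h) alg \<Rightarrow> ('f, 'v) fm set set" where
  "elementary_theory \<Theta> X0 H = {u. (\<exists>p. wf_fo (sgn \<Theta>) X0 p \<and> u = fo_class \<Theta> X0 p \<and> free_vars p = {}) \<and>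
     Val \<Theta> X0 H X0 u = Hom \<Theta> (W \<Theta> X0) H}"

text \<open>Consistency in the Lindenbaum--Tarski algebra: no finite conjunction is the zero.\<close>

definition consistent :: "'f variety \<Rightarrow> 'v set \<Rightarrow> ('f, 'v) fm set set \<Rightarrow> bool" where
  "consistent \<Theta> X0 U \<longleftrightarrow> (\<forall>us. set us \<subseteq> U \<longrightarrow> meets (Phi \<Theta> X0) X0 us \<noteq> zer (Phi \<Theta> X0) X0)"

definition X_type :: "'f variety \<Rightarrow> 'v set \<Rightarrow> ('f, 'h) alg \<Rightarrow> 'v set \<Rightarrow> ('f, 'v) fm set set \<Rightarrow> bool" where
  "X_type \<Theta> X0 H X T \<longleftrightarrow> (\<forall>u\<in>T. X_special \<Theta> X0 X u) \<and>
     consistent \<Theta> X0 (T \<union> elementary_theory \<Theta> X0 H)"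

definition Tp :: "'f variety \<Rightarrow> 'v set \<Rightarrow> ('f, 'h) alg \<Rightarrow> 'v set \<Rightarrow> (('f, 'v) wd \<Rightarrow> 'h) \<Rightarrow>
    ('f, 'v) fm set set" where
  "Tp \<Theta> X0 H X \<mu> = {u. X_special \<Theta> X0 X u \<and>
     (\<forall>\<eta>\<in>Hom \<Theta> (W \<Theta> X0) H. (\<forall>x\<in>X. \<eta> (var \<Theta> X0 x) = \<mu> (var \<Theta> X x)) \<longrightarrow> \<eta> \<in> Val \<Theta> X0 H X0 u)}"

definition L0_closure :: "'f variety \<Rightarrow> 'v set \<Rightarrow> ('f, 'h) alg \<Rightarrow> 'v set \<Rightarrow> ('f, 'v) fm set set \<Rightarrow>
    (('f, 'v) wd \<Rightarrow> 'h) set" where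
  "L0_closure \<Theta> X0 H X T = {\<mu> \<in> Hom \<Theta> (W \<Theta> X) H. T \<subseteq> Tp \<Theta> X0 H X \<mu>}"

definition special_hom :: "'f variety \<Rightarrow> 'v set \<Rightarrow> 'v set \<Rightarrow> (('f, 'v) wd \<Rightarrow> ('f, 'v) wd) \<Rightarrow> bool" where
  "special_hom \<Theta> X0 X s \<longleftrightarrow> s \<in> Hom \<Theta> (W \<Theta> X0) (W \<Theta> X) \<and> (\<forall>x\<in>X. s (var \<Theta> X0 x) = var \<Theta> X x)"


section \<open>Existence and uniqueness of the value maps\<close>

text \<open>This section justifies the definite description in the definition of \<^const>\<open>Val\<close>: every
  \<open>Hal \<Theta> H\<close> is a Halmos algebra (\<open>halmos_Hal\<close>), \<open>Phi \<Theta> X0\<close> is a Halmos algebra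
  (\<open>Phi_halmos\<close>), and it has exactly one homomorphism to any Halmos algebra
  (\<open>Phi_initial\<close>). Also, \<open>W \<Theta> X\<close> is free in the variety (\<open>W_in_variety\<close>,
  \<open>Hom_extend\<close>, \<open>Hom_eqI\<close>).\<close>

lemma list_image: assumes "set ws \<subseteq> f ` A" obtains ts where "ws = map f ts" "set ts \<subseteq> A"
proof -
  have "ws \<in> lists (f ` A)" using assms by auto
  then show thesis unfolding lists_image using that by auto
qed

lemma ev_closed:
  assumes "is_alg S A" "t \<in> terms S X" "\<And>x. x \<in> X \<Longrightarrow> \<alpha> x \<in> univ A"
  shows "ev A \<alpha> t \<in> univ A"
  using assms(2)
proof induction
  case (App f ts)
  have "set (map (ev A \<alpha>) ts) \<subseteq> univ A" "(f, length (map (ev A \<alpha>) ts)) \<in> S" using App by auto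
  then show ?case using assms(1) unfolding is_alg_def by (metis ev.simps(2))
qed (use assms in auto)

lemma ev_subst: "ev A \<alpha> (ev (term_alg S X) \<sigma> t) = ev A (\<lambda>x. ev A \<alpha> (\<sigma> x)) t"
  by (induction t) (auto simp: term_alg_def cong: map_cong)

lemma ev_agree: "(\<And>x. x \<in> tvars t \<Longrightarrow> \<alpha> x = \<beta> x) \<Longrightarrow> ev A \<alpha> t = ev A \<beta> t"
proof (induction t)
  case (Op f ts)
  then have "map (ev A \<alpha>) ts = map (ev A \<beta>) ts" by (intro map_cong refl Op.IH) auto
  then show ?case by (simp del: map_eq_conv)
qed auto

lemma terms_tvars: "t \<in> terms S X \<Longrightarrow> tvars t \<subseteq> X"
  by (induction rule: terms.induct) auto

lemma is_alg_term: "is_alg S (term_alg S X)"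
  by (auto simp: is_alg_def term_alg_def intro: terms.App)

lemma teq_terms:
  assumes "is_variety \<Theta>" "teq \<Theta> X t u"
  shows "t \<in> terms (sgn \<Theta>) X \<and> u \<in> terms (sgn \<Theta>) X"
  using assms(2)
proof induction
  case (cong f ts us)
  then have "length ts = length us" "\<forall>t\<in>set ts. t \<in> terms (sgn \<Theta>) X" "\<forall>t\<in>set us. t \<in> terms (sgn \<Theta>) X"
    by (auto simp: list_all2_conv_all_nth in_set_conv_nth)
  then show ?case using cong by (auto intro: terms.App)
next
  case (inst l r \<sigma>)
  have "l \<in> terms (sgn \<Theta>) UNIV" "r \<in> terms (sgn \<Theta>) UNIV" using assms(1) inst by (auto simp: is_variety_def)
  then have "ev (term_alg (sgn \<Theta>) X) \<sigma> l \<in> univ (term_alg (sgn \<Theta>) X)"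
     "ev (term_alg (sgn \<Theta>) X) \<sigma> r \<in> univ (term_alg (sgn \<Theta>) X)"
    using inst using ev_closed[OF is_alg_term, of l "sgn \<Theta>" UNIV \<sigma> X] ev_closed[OF is_alg_term, of r "sgn \<Theta>" UNIV \<sigma> X]
    by (auto simp: term_alg_def image_subset_iff)
  then show ?case by (simp add: term_alg_def)
qed auto

lemma teq_sound:
  assumes "in_variety \<Theta> A" "teq \<Theta> X t u" "\<And>x. x \<in> X \<Longrightarrow> \<alpha> x \<in> univ A"
  shows "ev A \<alpha> t = ev A \<alpha> u"
  using assms(2)
proof induction
  case (cong f ts us)
  then have "map (ev A \<alpha>) ts = map (ev A \<alpha>) us"
    by (auto simp: list_all2_conv_all_nth intro!: nth_equalityI)
  then show ?case by (simp del: map_eq_conv)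
next
  case (inst l r \<sigma>)
  have "range (\<lambda>x. ev A \<alpha> (\<sigma> x)) \<subseteq> univ A"
    using inst assms by (auto simp: in_variety_def intro!: ev_closed[where S="sgn \<Theta>" and X=X])
  then show ?case using assms(1) inst unfolding ev_subst in_variety_def by fast
qed auto

lemma cls_eq_iff:
  assumes "is_variety \<Theta>" "t \<in> terms (sgn \<Theta>) X"
  shows "cls \<Theta> X t = cls \<Theta> X u \<longleftrightarrow> teq \<Theta> X t u"
  unfolding cls_def using assms by (auto intro: teq.intros)

lemma univ_W: "univ (W \<Theta> X) = cls \<Theta> X ` terms (sgn \<Theta>) X"
  by (simp add: W_def)

lemma var_W: "x \<in> X \<Longrightarrow> var \<Theta> X x \<in> univ (W \<Theta> X)"
  by (auto simp: univ_W intro: terms.Var)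

lemma opn_W:
  assumes "is_variety \<Theta>" "(f, length ts) \<in> sgn \<Theta>" "set ts \<subseteq> terms (sgn \<Theta>) X"
  shows "opn (W \<Theta> X) f (map (cls \<Theta> X) ts) = cls \<Theta> X (Op f ts)"
proof -
  have "teq \<Theta> X (Op f ts) u" if "list_all2 (\<in>) us (map (cls \<Theta> X) ts)" "teq \<Theta> X (Op f us) u" for us u
  proof -
    have "list_all2 (teq \<Theta> X) ts us" using that(1)
      by (auto simp: list_all2_conv_all_nth cls_def)
    then show ?thesis using that assms by (auto intro: teq.trans teq.cong)
  qed
  moreover have "list_all2 (\<in>) ts (map (cls \<Theta> X) ts)"
    using assms by (auto simp: list_all2_conv_all_nth cls_def intro!: teq.refl)
  ultimately show ?thesis by (auto simp: W_def cls_def)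
qed

lemma Hom_ev:
  assumes "is_variety \<Theta>" "h \<in> Hom \<Theta> (W \<Theta> X) A" "t \<in> terms (sgn \<Theta>) X"
  shows "h (cls \<Theta> X t) = ev A (\<lambda>x. h (var \<Theta> X x)) t"
  using assms(3)
proof induction
  case (App f ts)
  then have "h (cls \<Theta> X (Op f ts)) = h (opn (W \<Theta> X) f (map (cls \<Theta> X) ts))"
    by (subst opn_W) (auto simp: assms)
  also have "\<dots> = opn A f (map h (map (cls \<Theta> X) ts))"
  proof -
    have "(f, length (map (cls \<Theta> X) ts)) \<in> sgn \<Theta>" "set (map (cls \<Theta> X) ts) \<subseteq> univ (W \<Theta> X)"
      using App by (auto simp: univ_W)
    then show ?thesis using assms(2) unfolding Hom_def by blast
  qed
  finally show ?case using App by (simp cong: map_cong)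
qed auto

lemma Hom_eqI:
  assumes "is_variety \<Theta>" "h \<in> Hom \<Theta> (W \<Theta> X) A" "g \<in> Hom \<Theta> (W \<Theta> X) A"
    "\<And>x. x \<in> X \<Longrightarrow> h (var \<Theta> X x) = g (var \<Theta> X x)"
  shows "h = g"
proof (rule PiE_ext[where k="univ (W \<Theta> X)" and s="\<lambda>_. univ A"])
  fix w assume "w \<in> univ (W \<Theta> X)"
  then obtain t where t: "t \<in> terms (sgn \<Theta>) X" "w = cls \<Theta> X t" by (auto simp: univ_W)
  then show "h w = g w" using assms terms_tvars[OF t(1)]
    by (auto simp: Hom_ev intro!: ev_agree)
qed (use assms in \<open>auto simp: Hom_def\<close>)

lemma Hom_extend:
  assumes "is_variety \<Theta>" "in_variety \<Theta> A" "\<And>x. x \<in> X \<Longrightarrow> \<alpha> x \<in> univ A"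
  obtains h where "h \<in> Hom \<Theta> (W \<Theta> X) A" "\<And>x. x \<in> X \<Longrightarrow> h (var \<Theta> X x) = \<alpha> x"
    "\<And>t. t \<in> terms (sgn \<Theta>) X \<Longrightarrow> h (cls \<Theta> X t) = ev A \<alpha> t"
proof -
  define h where "h = (\<lambda>w\<in>univ (W \<Theta> X). ev A \<alpha> (SOME t. t \<in> w))"
  have h: "h (cls \<Theta> X t) = ev A \<alpha> t" if "t \<in> terms (sgn \<Theta>) X" for t
  proof -
    have "t \<in> cls \<Theta> X t" using that by (auto simp: cls_def intro: teq.refl)
    then have "teq \<Theta> X t (SOME u. u \<in> cls \<Theta> X t)" by (metis someI cls_def mem_Collect_eq)
    from teq_sound[OF assms(2) this, of \<alpha>] show ?thesis using that assms by (auto simp: h_def univ_W)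
  qed
  have "h \<in> Hom \<Theta> (W \<Theta> X) A"
    unfolding Hom_def
  proof (intro CollectI conjI allI impI)
    show "h \<in> univ (W \<Theta> X) \<rightarrow>\<^sub>E univ A"
    proof
      fix w assume "w \<in> univ (W \<Theta> X)"
      then show "h w \<in> univ A" using h assms ev_closed[of "sgn \<Theta>" A _ X \<alpha>]
        by (auto simp: univ_W in_variety_def)
    qed (auto simp: h_def)
    fix f ws assume f: "(f, length ws) \<in> sgn \<Theta>" and ws: "set ws \<subseteq> univ (W \<Theta> X)"
    have "\<exists>ts. ws = map (cls \<Theta> X) ts \<and> set ts \<subseteq> terms (sgn \<Theta>) X"
      using ws unfolding univ_W by (elim list_image) blast
    then obtain ts where ts: "ws = map (cls \<Theta> X) ts" "set ts \<subseteq> terms (sgn \<Theta>) X" by blast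
    have "map h ws = map (ev A \<alpha>) ts" using ts h by (auto simp: subset_iff)
    moreover have "Op f ts \<in> terms (sgn \<Theta>) X" using ts f by (auto intro!: terms.App)
    moreover have "opn (W \<Theta> X) f ws = cls \<Theta> X (Op f ts)" using ts f by (simp add: opn_W[OF assms(1)])
    ultimately show "h (opn (W \<Theta> X) f ws) = opn A f (map h ws)" using h by (simp del: map_eq_conv)
  qed
  moreover have "h (var \<Theta> X x) = \<alpha> x" if "x \<in> X" for x using h[of "V x"] that by (simp add: terms.Var)
  ultimately show thesis using that h by blast
qed

lemma Hom_funD: "h \<in> Hom \<Theta> A B \<Longrightarrow> a \<in> univ A \<Longrightarrow> h a \<in> univ B"
  by (auto simp: Hom_def)

lemma Hom_compose:
  assumes "is_alg (sgn \<Theta>) A" "g \<in> Hom \<Theta> A B" "h \<in> Hom \<Theta> B C"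
  shows "compose (univ A) h g \<in> Hom \<Theta> A C"
  unfolding Hom_def
proof (intro CollectI conjI allI impI)
  show "compose (univ A) h g \<in> univ A \<rightarrow>\<^sub>E univ C"
    using assms by (auto simp: Hom_def compose_def)
  fix f as assume f: "(f, length as) \<in> sgn \<Theta>" "set as \<subseteq> univ A"
  then have g: "opn A f as \<in> univ A" "g (opn A f as) = opn B f (map g as)"
    using assms(1,2) by (auto simp: is_alg_def Hom_def)
  have "set (map g as) \<subseteq> univ B" using f assms(2) by (auto simp: Hom_def)
  moreover have "(f, length (map g as)) \<in> sgn \<Theta>" using f by simp
  ultimately have "h (opn B f (map g as)) = opn C f (map h (map g as))"
    using assms(3) unfolding Hom_def by blast
  then show "compose (univ A) h g (opn A f as) = opn C f (map (compose (univ A) h g) as)"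
    using g f by (auto simp: compose_def intro!: arg_cong[where f="opn C f"])
qed

lemma W_is_alg:
  assumes "is_variety \<Theta>" shows "is_alg (sgn \<Theta>) (W \<Theta> X)"
  unfolding is_alg_def
proof (intro allI impI)
  fix f ws assume f: "(f, length ws) \<in> sgn \<Theta>" "set ws \<subseteq> univ (W \<Theta> X)"
  then obtain ts where ts: "ws = map (cls \<Theta> X) ts" "set ts \<subseteq> terms (sgn \<Theta>) X"
    unfolding univ_W by (elim list_image)
  then show "opn (W \<Theta> X) f ws \<in> univ (W \<Theta> X)"
    using f assms opn_W[of \<Theta> f ts X] terms.App[of f ts "sgn \<Theta>" X] by (auto simp: univ_W)
qed

lemma W_in_variety:
  assumes "is_variety \<Theta>" shows "in_variety \<Theta> (W \<Theta> X)"
  unfolding in_variety_def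
proof (intro conjI ballI, rule W_is_alg[OF assms], clarify)
  fix l r and \<alpha> :: "nat \<Rightarrow> _" assume lr: "(l, r) \<in> ids \<Theta>" and \<alpha>: "range \<alpha> \<subseteq> univ (W \<Theta> X)"
  then have "\<forall>n. \<exists>t. t \<in> terms (sgn \<Theta>) X \<and> \<alpha> n = cls \<Theta> X t" by (auto simp: univ_W)
  then obtain \<sigma> where \<sigma>: "\<And>n. \<sigma> n \<in> terms (sgn \<Theta>) X" "\<And>n. \<alpha> n = cls \<Theta> X (\<sigma> n)" by metis
  have *: "ev (W \<Theta> X) \<alpha> t = cls \<Theta> X (ev (term_alg (sgn \<Theta>) X) \<sigma> t) \<and> ev (term_alg (sgn \<Theta>) X) \<sigma> t \<in> terms (sgn \<Theta>) X"
    if "t \<in> terms (sgn \<Theta>) UNIV" for t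
    using that
  proof induction
    case (App f ts)
    let ?ts = "map (ev (term_alg (sgn \<Theta>) X) \<sigma>) ts"
    have "map (ev (W \<Theta> X) \<alpha>) ts = map (cls \<Theta> X) ?ts" using App by auto
    then have "ev (W \<Theta> X) \<alpha> (Op f ts) = opn (W \<Theta> X) f (map (cls \<Theta> X) ?ts)"
      by (simp del: map_map)
    also have "\<dots> = cls \<Theta> X (Op f ?ts)" using App assms by (intro opn_W) auto
    finally show ?case using App by (auto simp: term_alg_def intro!: terms.App)
  qed (use \<sigma> in auto)
  have "teq \<Theta> X (ev (term_alg (sgn \<Theta>) X) \<sigma> l) (ev (term_alg (sgn \<Theta>) X) \<sigma> r)"
    using lr \<sigma> by (auto intro: teq.inst)
  moreover have "l \<in> terms (sgn \<Theta>) UNIV" "r \<in> terms (sgn \<Theta>) UNIV" using assms lr by (auto simp: is_variety_def)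
  ultimately show "ev (W \<Theta> X) \<alpha> l = ev (W \<Theta> X) \<alpha> r"
    using * cls_eq_iff[OF assms] by metis
qed

lemma meets_Hal:
  assumes "length ws = length ws'"
  shows "\<mu> \<in> meets (Hal \<Theta> H) X (map2 (eqn (Hal \<Theta> H) X) ws ws') \<longleftrightarrow>
     \<mu> \<in> Hom \<Theta> (W \<Theta> X) H \<and> map \<mu> ws = map \<mu> ws'"
  using assms by (induction ws ws' rule: list_induct2) (auto simp: meets_def Hal_def)

lemma halmos_Hal:
  fixes \<Theta> :: "'f variety" and X0 :: "'v set" and H :: "('f, 'h) alg"
  assumes V: "is_variety \<Theta>" and H: "in_variety \<Theta> H"
  shows "halmos_algebra \<Theta> X0 (Hal \<Theta> H)"
proof -
  note [simp] = W_is_alg[OF V]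
  have C: "\<mu> \<in> Hom \<Theta> (W \<Theta> Y) H \<Longrightarrow> s \<in> Hom \<Theta> (W \<Theta> X) (W \<Theta> Y) \<Longrightarrow> compose (univ (W \<Theta> X)) \<mu> s \<in> Hom \<Theta> (W \<Theta> X) H"
    for \<mu> and s and X Y :: "'v set"
    by (rule Hom_compose[of \<Theta> "W \<Theta> X" s "W \<Theta> Y" \<mu> H]) auto
  have Cv: "x \<in> X \<Longrightarrow> compose (univ (W \<Theta> X)) \<mu> s (var \<Theta> X x) = \<mu> (s (var \<Theta> X x))" for x X \<mu> s
    by (simp add: compose_def var_W)
  show ?thesis
  proof (unfold_locales, goal_cases)
    case (24 X f ws ws')
    show ?case unfolding leq_def
    proof -
      have "meets (Hal \<Theta> H) X (map2 (eqn (Hal \<Theta> H) X) ws ws') \<subseteq>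
         eqn (Hal \<Theta> H) X (opn (W \<Theta> X) f ws) (opn (W \<Theta> X) f ws')"
      proof
        fix \<mu> assume "\<mu> \<in> meets (Hal \<Theta> H) X (map2 (eqn (Hal \<Theta> H) X) ws ws')"
        then have "\<mu> \<in> Hom \<Theta> (W \<Theta> X) H" "map \<mu> ws = map \<mu> ws'" using meets_Hal 24 by metis+
        then show "\<mu> \<in> eqn (Hal \<Theta> H) X (opn (W \<Theta> X) f ws) (opn (W \<Theta> X) f ws')"
          using 24 by (auto simp: Hal_def Hom_def simp del: map_eq_conv)
      qed
      then show "meet (Hal \<Theta> H) X (meets (Hal \<Theta> H) X (map2 (eqn (Hal \<Theta> H) X) ws ws'))
          (eqn (Hal \<Theta> H) X (opn (W \<Theta> X) f ws) (opn (W \<Theta> X) f ws')) =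
         meets (Hal \<Theta> H) X (map2 (eqn (Hal \<Theta> H) X) ws ws')"
        by (auto simp: Hal_def)
    qed
  next
    case (20 X x y a)
    have *: "\<exists>\<nu>\<in>Hom \<Theta> (W \<Theta> X) H. (\<exists>\<rho>\<in>a. \<forall>z\<in>X. z \<noteq> x \<longrightarrow> \<rho> (var \<Theta> X z) = \<nu> (var \<Theta> X z)) \<and>
        (\<forall>z\<in>X. z \<noteq> y \<longrightarrow> \<nu> (var \<Theta> X z) = \<mu> (var \<Theta> X z))"
      if \<mu>: "\<mu> \<in> Hom \<Theta> (W \<Theta> X) H" and r: "\<rho> \<in> a" "\<rho> \<in> Hom \<Theta> (W \<Theta> X) H" and n: "\<And>z. z \<in> X \<Longrightarrow> z \<noteq> x \<Longrightarrow> z \<noteq> y \<Longrightarrow> \<rho> (var \<Theta> X z) = \<mu> (var \<Theta> X z)"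
      and "x \<in> X" "y \<in> X"
      for \<mu> x y \<rho>
    proof -
      have "(if z = y then \<rho> (var \<Theta> X y) else \<mu> (var \<Theta> X z)) \<in> univ H" if "z \<in> X" for z
        using that \<mu> r by (auto intro: Hom_funD var_W)
      note z = this
      obtain \<nu> where \<nu>: "\<nu> \<in> Hom \<Theta> (W \<Theta> X) H"
        "\<And>z. z \<in> X \<Longrightarrow> \<nu> (var \<Theta> X z) = (if z = y then \<rho> (var \<Theta> X y) else \<mu> (var \<Theta> X z))"
        by (rule Hom_extend[OF V H, of X "\<lambda>z. if z = y then \<rho> (var \<Theta> X y) else \<mu> (var \<Theta> X z)", OF z]; (assumption | erule that, simp))
      show ?thesis
        by (intro bexI[OF _ \<nu>(1)] conjI bexI[OF _ r(1)]) (use \<nu> n in auto)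
    qed
    have sub: "a \<subseteq> Hom \<Theta> (W \<Theta> X) H" using 20 by (auto simp: Hal_def)
    have **: "ex (Hal \<Theta> H) X x (ex (Hal \<Theta> H) X y a) = {\<mu>\<in>Hom \<Theta> (W \<Theta> X) H. \<exists>\<rho>\<in>a. \<forall>z\<in>X. z \<noteq> x \<longrightarrow> z \<noteq> y \<longrightarrow> \<rho> (var \<Theta> X z) = \<mu> (var \<Theta> X z)}"
      if "x \<in> X" "y \<in> X" for x y
    proof (intro set_eqI iffI)
      fix \<mu> assume "\<mu> \<in> {\<mu>\<in>Hom \<Theta> (W \<Theta> X) H. \<exists>\<rho>\<in>a. \<forall>z\<in>X. z \<noteq> x \<longrightarrow> z \<noteq> y \<longrightarrow> \<rho> (var \<Theta> X z) = \<mu> (var \<Theta> X z)}"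
      then obtain \<rho> where "\<mu> \<in> Hom \<Theta> (W \<Theta> X) H" "\<rho> \<in> a" "\<And>z. z \<in> X \<Longrightarrow> z \<noteq> y \<Longrightarrow> z \<noteq> x \<Longrightarrow> \<rho> (var \<Theta> X z) = \<mu> (var \<Theta> X z)" by blast
      from *[OF this(1,2) _ this(3) that(2,1)] sub this
      show "\<mu> \<in> ex (Hal \<Theta> H) X x (ex (Hal \<Theta> H) X y a)" by (auto simp: Hal_def)
    next
      fix \<mu> assume "\<mu> \<in> ex (Hal \<Theta> H) X x (ex (Hal \<Theta> H) X y a)"
      then show "\<mu> \<in> {\<mu>\<in>Hom \<Theta> (W \<Theta> X) H. \<exists>\<rho>\<in>a. \<forall>z\<in>X. z \<noteq> x \<longrightarrow> z \<noteq> y \<longrightarrow> \<rho> (var \<Theta> X z) = \<mu> (var \<Theta> X z)}"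
        unfolding Hal_def by simp metis
    qed
    show ?case using 20 by (auto simp: **)
  next
    case (30 X a)
    have "\<mu> \<in> Hom \<Theta> (W \<Theta> X) H \<Longrightarrow> compose (univ (W \<Theta> X)) \<mu> (\<lambda>w\<in>univ (W \<Theta> X). w) = \<mu>" for \<mu>
      by (auto simp: Hom_def compose_def fun_eq_iff PiE_def extensional_def)
    then show ?case using 30 by (auto simp: Hal_def)
  next
    case (31 X Y Z s s' a)
    have "compose (univ (W \<Theta> X)) (compose (univ (W \<Theta> Y)) \<mu> s') s = compose (univ (W \<Theta> X)) \<mu> (compose (univ (W \<Theta> X)) s' s)"
      for \<mu> :: "('f,'v) wd \<Rightarrow> 'h" using 31 by (auto simp: compose_def fun_eq_iff Hom_funD)
    then show ?case using 31 by (auto simp: Hal_def C)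
  next
    case (33 X Y s x y a)
    have sub: "a \<subseteq> Hom \<Theta> (W \<Theta> X) H" using 33 by (auto simp: Hal_def)
    show ?case
    proof (intro set_eqI iffI)
      fix \<mu> assume "\<mu> \<in> sub (Hal \<Theta> H) X Y s (ex (Hal \<Theta> H) X x a)"
      then obtain \<nu> where \<mu>: "\<mu> \<in> Hom \<Theta> (W \<Theta> Y) H" and \<nu>: "\<nu> \<in> a"
        "\<And>z. z \<in> X \<Longrightarrow> z \<noteq> x \<Longrightarrow> \<nu> (var \<Theta> X z) = \<mu> (s (var \<Theta> X z))"
        by (auto simp: Hal_def Cv)
      have \<nu>H: "\<nu> \<in> Hom \<Theta> (W \<Theta> X) H" using \<nu> sub by auto
      have "(if z = y then \<nu> (var \<Theta> X x) else \<mu> (var \<Theta> Y z)) \<in> univ H" if "z \<in> Y" for z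
        using that \<mu> \<nu>H 33 by (auto intro: Hom_funD var_W)
      note z = this
      obtain \<rho> where \<rho>: "\<rho> \<in> Hom \<Theta> (W \<Theta> Y) H"
        "\<And>z. z \<in> Y \<Longrightarrow> \<rho> (var \<Theta> Y z) = (if z = y then \<nu> (var \<Theta> X x) else \<mu> (var \<Theta> Y z))"
        by (rule Hom_extend[OF V H, of Y "\<lambda>z. if z = y then \<nu> (var \<Theta> X x) else \<mu> (var \<Theta> Y z)", OF z]; (assumption | erule that, simp))
      have av: "\<rho> (s (var \<Theta> X z)) = \<mu> (s (var \<Theta> X z))" if z: "z \<in> X" "z \<noteq> x" for z
      proof -
        from 33(7)[OF z] obtain t where t: "t \<in> s (var \<Theta> X z)" "y \<notin> tvars t" by (auto simp: avoids_def)
        have "s (var \<Theta> X z) \<in> univ (W \<Theta> Y)" using 33 z by (auto intro: Hom_funD var_W)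
        then obtain t' where t': "t' \<in> terms (sgn \<Theta>) Y" "s (var \<Theta> X z) = cls \<Theta> Y t'" by (auto simp: univ_W)
        then have "teq \<Theta> Y t' t" using t by (simp add: cls_def)
        then have tt: "t \<in> terms (sgn \<Theta>) Y" "s (var \<Theta> X z) = cls \<Theta> Y t"
          using teq_terms[OF V] cls_eq_iff[OF V] t' by metis+
        then show ?thesis using \<rho> \<mu> t terms_tvars[OF tt(1)]
          by (auto simp: Hom_ev[OF V] intro!: ev_agree)
      qed
      have "compose (univ (W \<Theta> X)) \<rho> s = \<nu>"
      proof (rule Hom_eqI[OF V C[OF \<rho>(1) 33(3)] \<nu>H])
        fix z assume "z \<in> X"
        then show "compose (univ (W \<Theta> X)) \<rho> s (var \<Theta> X z) = \<nu> (var \<Theta> X z)"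
          using av \<nu> \<rho> 33 by (cases "z = x") (auto simp: Cv)
      qed
      then show "\<mu> \<in> ex (Hal \<Theta> H) Y y (sub (Hal \<Theta> H) X Y s a)"
        using \<rho> \<mu> \<nu> by (auto simp: Hal_def intro!: exI[of _ \<rho>])
    next
      fix \<mu> assume "\<mu> \<in> ex (Hal \<Theta> H) Y y (sub (Hal \<Theta> H) X Y s a)"
      then obtain \<rho> where \<mu>: "\<mu> \<in> Hom \<Theta> (W \<Theta> Y) H" and \<rho>: "\<rho> \<in> Hom \<Theta> (W \<Theta> Y) H"
        "compose (univ (W \<Theta> X)) \<rho> s \<in> a"
        "\<And>z. z \<in> Y \<Longrightarrow> z \<noteq> y \<Longrightarrow> \<rho> (var \<Theta> Y z) = \<mu> (var \<Theta> Y z)"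
        by (auto simp: Hal_def)
      have av: "\<rho> (s (var \<Theta> X z)) = \<mu> (s (var \<Theta> X z))" if z: "z \<in> X" "z \<noteq> x" for z
      proof -
        from 33(7)[OF z] obtain t where t: "t \<in> s (var \<Theta> X z)" "y \<notin> tvars t" by (auto simp: avoids_def)
        have "s (var \<Theta> X z) \<in> univ (W \<Theta> Y)" using 33 z by (auto intro: Hom_funD var_W)
        then obtain t' where t': "t' \<in> terms (sgn \<Theta>) Y" "s (var \<Theta> X z) = cls \<Theta> Y t'" by (auto simp: univ_W)
        then have "teq \<Theta> Y t' t" using t by (simp add: cls_def)
        then have tt: "t \<in> terms (sgn \<Theta>) Y" "s (var \<Theta> X z) = cls \<Theta> Y t"
          using teq_terms[OF V] cls_eq_iff[OF V] t' by metis+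
        then show ?thesis using \<rho> \<mu> t terms_tvars[OF tt(1)]
          by (auto simp: Hom_ev[OF V] intro!: ev_agree)
      qed
      show "\<mu> \<in> sub (Hal \<Theta> H) X Y s (ex (Hal \<Theta> H) X x a)"
        using \<mu> \<rho> av C[OF \<mu> 33(3)] by (auto simp: Hal_def Cv intro!: bexI[OF _ \<rho>(2)])
    qed
  next
    case (32 X Y s s' x a)
    then show ?case by (auto simp: Hal_def C Cv)
  next
    case (35 X x w w' s s' a)
    have "compose (univ (W \<Theta> X)) \<mu> s = compose (univ (W \<Theta> X)) \<mu> s'" if "\<mu> \<in> Hom \<Theta> (W \<Theta> X) H" "\<mu> w = \<mu> w'" for \<mu>
    proof (rule Hom_eqI[OF V C[OF that(1) 35(5)] C[OF that(1) 35(6)]])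
      fix z assume "z \<in> X"
      then show "compose (univ (W \<Theta> X)) \<mu> s (var \<Theta> X z) = compose (univ (W \<Theta> X)) \<mu> s' (var \<Theta> X z)"
        using 35 that by (cases "z = x") (auto simp: Cv)
    qed
    then show ?case using 35 by (auto simp: Hal_def leq_def)
  next
    case (19 X x a b)
    then have sb: "a \<subseteq> Hom \<Theta> (W \<Theta> X) H" "b \<subseteq> Hom \<Theta> (W \<Theta> X) H" by (auto simp: Hal_def)
    have "\<mu> \<in> ex (Hal \<Theta> H) X x (meet (Hal \<Theta> H) X a (ex (Hal \<Theta> H) X x b)) \<longleftrightarrow>
      \<mu> \<in> meet (Hal \<Theta> H) X (ex (Hal \<Theta> H) X x a) (ex (Hal \<Theta> H) X x b)" (is "?l \<longleftrightarrow> ?r") for \<mu>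
    proof
      assume ?l
      then obtain \<nu> \<rho> where 1: "\<mu> \<in> Hom \<Theta> (W \<Theta> X) H" "\<nu> \<in> a" "\<rho> \<in> b" "\<forall>y\<in>X. y \<noteq> x \<longrightarrow> \<nu> (var \<Theta> X y) = \<mu> (var \<Theta> X y)"
        "\<forall>y\<in>X. y \<noteq> x \<longrightarrow> \<rho> (var \<Theta> X y) = \<nu> (var \<Theta> X y)" by (auto simp: Hal_def)
      then have "\<forall>y\<in>X. y \<noteq> x \<longrightarrow> \<rho> (var \<Theta> X y) = \<mu> (var \<Theta> X y)" by simp
      then show ?r using 1 by (simp add: Hal_def) blast
    next
      assume ?r
      then obtain \<nu> \<rho> where 1: "\<mu> \<in> Hom \<Theta> (W \<Theta> X) H" "\<nu> \<in> a" "\<rho> \<in> b" "\<forall>y\<in>X. y \<noteq> x \<longrightarrow> \<nu> (var \<Theta> X y) = \<mu> (var \<Theta> X y)"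
        "\<forall>y\<in>X. y \<noteq> x \<longrightarrow> \<rho> (var \<Theta> X y) = \<mu> (var \<Theta> X y)" by (auto simp: Hal_def)
      then have "\<forall>y\<in>X. y \<noteq> x \<longrightarrow> \<rho> (var \<Theta> X y) = \<nu> (var \<Theta> X y)" by simp
      then have "\<nu> \<in> ex (Hal \<Theta> H) X x b" using 1 sb unfolding Hal_def by simp blast
      then have "\<nu> \<in> meet (Hal \<Theta> H) X a (ex (Hal \<Theta> H) X x b)" using 1 by (simp add: Hal_def)
      then show ?l using 1 by (subst Hal_def) (simp, rule bexI[of _ \<nu>], auto)
    qed
    then show ?case by blast
  next
    case (34 X Y s w w')
    then show ?case by (simp add: Hal_def C compose_eq cong: conj_cong)
  qed ((simp_all add: Hal_def leq_def C), (auto intro: C)+)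

qed

lemma halmos_homD:
  assumes "halmos_hom \<Theta> X0 L M h" "X \<in> sorts X0"
  shows "h X (zer L X) = zer M X" "h X (one L X) = one M X"
   "a \<in> dom L X \<Longrightarrow> h X a \<in> dom M X"
   "a \<in> dom L X \<Longrightarrow> h X (neg L X a) = neg M X (h X a)"
   "a \<in> dom L X \<Longrightarrow> b \<in> dom L X \<Longrightarrow> h X (meet L X a b) = meet M X (h X a) (h X b)"
   "a \<in> dom L X \<Longrightarrow> b \<in> dom L X \<Longrightarrow> h X (join L X a b) = join M X (h X a) (h X b)"
   "x \<in> X \<Longrightarrow> a \<in> dom L X \<Longrightarrow> h X (ex L X x a) = ex M X x (h X a)"
   "w \<in> univ (W \<Theta> X) \<Longrightarrow> w' \<in> univ (W \<Theta> X) \<Longrightarrow> h X (eqn L X w w') = eqn M X w w'"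
   "Y \<in> sorts X0 \<Longrightarrow> s \<in> Hom \<Theta> (W \<Theta> X) (W \<Theta> Y) \<Longrightarrow> a \<in> dom L X \<Longrightarrow>
        h Y (sub L X Y s a) = sub M X Y s (h X a)"
  using assms unfolding halmos_hom_def PiE_def Pi_def by auto

lemma (in halmos_sig) meets_closed: "X \<in> sorts X0 \<Longrightarrow> set as \<subseteq> dom L X \<Longrightarrow> meets L X as \<in> dom L X"
  by (induction as) (auto simp: meets_def one_closed meet_closed)

lemma (in halmos_sig) meets_hom:
  assumes "halmos_hom \<Theta> X0 L M h" "X \<in> sorts X0" "set as \<subseteq> dom L X"
  shows "h X (meets L X as) = meets M X (map (h X) as)"
  using assms(3)
proof (induction as)
  case (Cons a as)
  then have "meets L X as \<in> dom L X" using meets_closed assms by auto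
  then show ?case using Cons halmos_homD(5)[OF assms(1,2), of a "meets L X as"] by (simp add: meets_def)
qed (simp add: meets_def halmos_homD(2)[OF assms(1,2)])

lemma W_opn: "is_variety \<Theta> \<Longrightarrow> (f, length ws) \<in> sgn \<Theta> \<Longrightarrow> set ws \<subseteq> univ (W \<Theta> X) \<Longrightarrow> opn (W \<Theta> X) f ws \<in> univ (W \<Theta> X)"
  using W_is_alg unfolding is_alg_def by blast

lemma idW: fixes \<Theta> :: "'a variety" and X :: "'b set" shows "is_variety \<Theta> \<Longrightarrow> (\<lambda>w\<in>univ (W \<Theta> X). w) \<in> Hom \<Theta> (W \<Theta> X) (W \<Theta> X)"
  unfolding Hom_def
proof (intro CollectI conjI allI impI)
  fix f and ws :: "('a, 'b) wd list"
  assume a: "is_variety \<Theta>" "(f, length ws) \<in> sgn \<Theta>" "set ws \<subseteq> univ (W \<Theta> X)"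
  then have "map (\<lambda>w\<in>univ (W \<Theta> X). w) ws = ws" by (auto intro!: map_idI)
  then show "(\<lambda>w\<in>univ (W \<Theta> X). w) (opn (W \<Theta> X) f ws) = opn (W \<Theta> X) f (map (\<lambda>w\<in>univ (W \<Theta> X). w) ws)"
    using W_opn[OF a] by simp
qed auto

lemma halmos_separated:
  fixes L :: "('f,'v,'l) halmos" and \<Theta> :: "'f variety"
  assumes V: "is_variety \<Theta>" and S: "halmos_sig \<Theta> X0 L"
    and sep: "\<And>X a b. X \<in> sorts X0 \<Longrightarrow> a \<in> dom L X \<Longrightarrow> b \<in> dom L X \<Longrightarrow> a \<noteq> b \<Longrightarrow>
       \<exists>(M::('f,'v,'m) halmos) h. halmos_algebra \<Theta> X0 M \<and> halmos_hom \<Theta> X0 L M h \<and> h X a \<noteq> h X b"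
  shows "halmos_algebra \<Theta> X0 L"
proof -
  interpret halmos_sig \<Theta> X0 L by fact
  have eqI: "a = b" if "X \<in> sorts X0" "a \<in> dom L X" "b \<in> dom L X"
     "\<And>(M::('f,'v,'m) halmos) h. halmos_algebra \<Theta> X0 M \<Longrightarrow> halmos_hom \<Theta> X0 L M h \<Longrightarrow> h X a = h X b" for X a b
    using sep that by metis
  note cl = zer_closed one_closed neg_closed meet_closed join_closed ex_closed eqn_closed sub_closed idW[OF V]
     Hom_funD[of _ \<Theta> "W \<Theta> _" "W \<Theta> _"] Hom_compose[OF W_is_alg[OF V]] W_opn[OF V]
  have ma: "set (map2 (eqn L X) ws ws') \<subseteq> dom L X" if "X \<in> sorts X0" "set ws \<subseteq> univ (W \<Theta> X)" "set ws' \<subseteq> univ (W \<Theta> X)" for X ws ws'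
    using that by (auto simp: subset_iff intro!: eqn_closed dest: set_zip_leftD set_zip_rightD)
  show ?thesis
  proof (unfold_locales, goal_cases)
    case 1 note C = this
    show ?case unfolding leq_def
    proof (rule eqI[OF C(1)], goal_cases)
      case (3 M h) note hm = halmos_homD[OF 3(2)]
      interpret M: halmos_algebra \<Theta> X0 M by (fact 3(1))
      note hm' = M.meet_comm[unfolded leq_def, OF C(1)] hm(3)
      show ?case using C by (simp add: hm cl hm')
    qed (use C in \<open>simp_all add: cl\<close>)
  next
    case 2 note C = this
    show ?case unfolding leq_def
    proof (rule eqI[OF C(1)], goal_cases)
      case (3 M h) note hm = halmos_homD[OF 3(2)]
      interpret M: halmos_algebra \<Theta> X0 M by (fact 3(1))
      note hm' = M.join_comm[unfolded leq_def, OF C(1)] hm(3)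
      show ?case using C by (simp add: hm cl hm')
    qed (use C in \<open>simp_all add: cl\<close>)
  next
    case 3 note C = this
    show ?case unfolding leq_def
    proof (rule eqI[OF C(1)], goal_cases)
      case (3 M h) note hm = halmos_homD[OF 3(2)]
      interpret M: halmos_algebra \<Theta> X0 M by (fact 3(1))
      note hm' = M.meet_join_distrib[unfolded leq_def, OF C(1)] hm(3)
      show ?case using C by (simp add: hm cl hm')
    qed (use C in \<open>simp_all add: cl\<close>)
  next
    case 4 note C = this
    show ?case unfolding leq_def
    proof (rule eqI[OF C(1)], goal_cases)
      case (3 M h) note hm = halmos_homD[OF 3(2)]
      interpret M: halmos_algebra \<Theta> X0 M by (fact 3(1))
      note hm' = M.join_meet_distrib[unfolded leq_def, OF C(1)] hm(3)
      show ?case using C by (simp add: hm cl hm')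
    qed (use C in \<open>simp_all add: cl\<close>)
  next
    case 5 note C = this
    show ?case unfolding leq_def
    proof (rule eqI[OF C(1)], goal_cases)
      case (3 M h) note hm = halmos_homD[OF 3(2)]
      interpret M: halmos_algebra \<Theta> X0 M by (fact 3(1))
      note hm' = M.meet_one[unfolded leq_def, OF C(1)] hm(3)
      show ?case using C by (simp add: hm cl hm')
    qed (use C in \<open>simp_all add: cl\<close>)
  next
    case 6 note C = this
    show ?case unfolding leq_def
    proof (rule eqI[OF C(1)], goal_cases)
      case (3 M h) note hm = halmos_homD[OF 3(2)]
      interpret M: halmos_algebra \<Theta> X0 M by (fact 3(1))
      note hm' = M.join_zer[unfolded leq_def, OF C(1)] hm(3)
      show ?case using C by (simp add: hm cl hm')
    qed (use C in \<open>simp_all add: cl\<close>)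
  next
    case 7 note C = this
    show ?case unfolding leq_def
    proof (rule eqI[OF C(1)], goal_cases)
      case (3 M h) note hm = halmos_homD[OF 3(2)]
      interpret M: halmos_algebra \<Theta> X0 M by (fact 3(1))
      note hm' = M.meet_neg[unfolded leq_def, OF C(1)] hm(3)
      show ?case using C by (simp add: hm cl hm')
    qed (use C in \<open>simp_all add: cl\<close>)
  next
    case 8 note C = this
    show ?case unfolding leq_def
    proof (rule eqI[OF C(1)], goal_cases)
      case (3 M h) note hm = halmos_homD[OF 3(2)]
      interpret M: halmos_algebra \<Theta> X0 M by (fact 3(1))
      note hm' = M.join_neg[unfolded leq_def, OF C(1)] hm(3)
      show ?case using C by (simp add: hm cl hm')
    qed (use C in \<open>simp_all add: cl\<close>)
  next
    case 9 note C = this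
    show ?case unfolding leq_def
    proof (rule eqI[OF C(1)], goal_cases)
      case (3 M h) note hm = halmos_homD[OF 3(2)]
      interpret M: halmos_algebra \<Theta> X0 M by (fact 3(1))
      note hm' = M.ex_zer[unfolded leq_def, OF C(1)] hm(3)
      show ?case using C by (simp add: hm cl hm')
    qed (use C in \<open>simp_all add: cl\<close>)
  next
    case 10 note C = this
    show ?case unfolding leq_def
    proof (rule eqI[OF C(1)], goal_cases)
      case (3 M h) note hm = halmos_homD[OF 3(2)]
      interpret M: halmos_algebra \<Theta> X0 M by (fact 3(1))
      note hm' = M.le_ex[unfolded leq_def, OF C(1)] hm(3)
      show ?case using C by (simp add: hm cl hm')
    qed (use C in \<open>simp_all add: cl\<close>)
  next
    case 11 note C = this
    show ?case unfolding leq_def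
    proof (rule eqI[OF C(1)], goal_cases)
      case (3 M h) note hm = halmos_homD[OF 3(2)]
      interpret M: halmos_algebra \<Theta> X0 M by (fact 3(1))
      note hm' = M.ex_meet[unfolded leq_def, OF C(1)] hm(3)
      show ?case using C by (simp add: hm cl hm')
    qed (use C in \<open>simp_all add: cl\<close>)
  next
    case 12 note C = this
    show ?case unfolding leq_def
    proof (rule eqI[OF C(1)], goal_cases)
      case (3 M h) note hm = halmos_homD[OF 3(2)]
      interpret M: halmos_algebra \<Theta> X0 M by (fact 3(1))
      note hm' = M.ex_comm[unfolded leq_def, OF C(1)] hm(3)
      show ?case using C by (simp add: hm cl hm')
    qed (use C in \<open>simp_all add: cl\<close>)
  next
    case 13 note C = this
    show ?case unfolding leq_def
    proof (rule eqI[OF C(1)], goal_cases)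
      case (3 M h) note hm = halmos_homD[OF 3(2)]
      interpret M: halmos_algebra \<Theta> X0 M by (fact 3(1))
      note hm' = M.eqn_refl[unfolded leq_def, OF C(1)] hm(3)
      show ?case using C by (simp add: hm cl hm')
    qed (use C in \<open>simp_all add: cl\<close>)
  next
    case 14 note C = this
    show ?case unfolding leq_def
    proof (rule eqI[OF C(1)], goal_cases)
      case (3 M h) note hm = halmos_homD[OF 3(2)]
      interpret M: halmos_algebra \<Theta> X0 M by (fact 3(1))
      note hm' = M.eqn_sym[unfolded leq_def, OF C(1)] hm(3)
      show ?case using C by (simp add: hm cl hm')
    qed (use C in \<open>simp_all add: cl\<close>)
  next
    case 15 note C = this
    show ?case unfolding leq_def
    proof (rule eqI[OF C(1)], goal_cases)
      case (3 M h) note hm = halmos_homD[OF 3(2)]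
      interpret M: halmos_algebra \<Theta> X0 M by (fact 3(1))
      note hm' = M.eqn_trans[unfolded leq_def, OF C(1)] hm(3)
      show ?case using C by (simp add: hm cl hm')
    qed (use C in \<open>simp_all add: cl\<close>)
  next
    case (16 X f ws ws')
    have mc: "meets L X (map2 (eqn L X) ws ws') \<in> dom L X" using meets_closed ma 16 by metis
    show ?case unfolding leq_def
    proof (rule eqI[OF 16(1)], goal_cases)
      case (3 M h) note hm = halmos_homD[OF 3(2)]
      have "map (h X) (map2 (eqn L X) ws ws') = map2 (eqn M X) ws ws'"
        using 16 by (auto simp: subset_iff intro!: hm(8) dest: set_zip_leftD set_zip_rightD)
      then have "h X (meets L X (map2 (eqn L X) ws ws')) = meets M X (map2 (eqn M X) ws ws')"
        using meets_hom[OF 3(2) 16(1) ma[OF 16(1) 16(4,5)]] by metis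
      then show ?case using halmos_algebra.eqn_cong[OF 3(1) 16] 16 mc by (simp add: hm cl leq_def)
    qed (use 16 mc in \<open>simp_all add: cl\<close>)
  next
    case 17 note C = this
    show ?case unfolding leq_def
    proof (rule eqI[OF C(2)], goal_cases)
      case (3 M h) note hm = halmos_homD[OF 3(2)]
      interpret M: halmos_algebra \<Theta> X0 M by (fact 3(1))
      note hm' = M.sub_zer[unfolded leq_def, OF C(1)] hm(3)
      show ?case using C by (simp add: hm cl hm')
    qed (use C in \<open>simp_all add: cl\<close>)
  next
    case 18 note C = this
    show ?case unfolding leq_def
    proof (rule eqI[OF C(2)], goal_cases)
      case (3 M h) note hm = halmos_homD[OF 3(2)]
      interpret M: halmos_algebra \<Theta> X0 M by (fact 3(1))
      note hm' = M.sub_one[unfolded leq_def, OF C(1)] hm(3)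
      show ?case using C by (simp add: hm cl hm')
    qed (use C in \<open>simp_all add: cl\<close>)
  next
    case 19 note C = this
    show ?case unfolding leq_def
    proof (rule eqI[OF C(2)], goal_cases)
      case (3 M h) note hm = halmos_homD[OF 3(2)]
      interpret M: halmos_algebra \<Theta> X0 M by (fact 3(1))
      note hm' = M.sub_neg[unfolded leq_def, OF C(1)] hm(3)
      show ?case using C by (simp add: hm cl hm')
    qed (use C in \<open>simp_all add: cl\<close>)
  next
    case 20 note C = this
    show ?case unfolding leq_def
    proof (rule eqI[OF C(2)], goal_cases)
      case (3 M h) note hm = halmos_homD[OF 3(2)]
      interpret M: halmos_algebra \<Theta> X0 M by (fact 3(1))
      note hm' = M.sub_meet[unfolded leq_def, OF C(1)] hm(3)
      show ?case using C by (simp add: hm cl hm')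
    qed (use C in \<open>simp_all add: cl\<close>)
  next
    case 21 note C = this
    show ?case unfolding leq_def
    proof (rule eqI[OF C(2)], goal_cases)
      case (3 M h) note hm = halmos_homD[OF 3(2)]
      interpret M: halmos_algebra \<Theta> X0 M by (fact 3(1))
      note hm' = M.sub_join[unfolded leq_def, OF C(1)] hm(3)
      show ?case using C by (simp add: hm cl hm')
    qed (use C in \<open>simp_all add: cl\<close>)
  next
    case 22 note C = this
    show ?case unfolding leq_def
    proof (rule eqI[OF C(1)], goal_cases)
      case (3 M h) note hm = halmos_homD[OF 3(2)]
      interpret M: halmos_algebra \<Theta> X0 M by (fact 3(1))
      note hm' = M.sub_id[unfolded leq_def, OF C(1)] hm(3)
      show ?case using C by (simp add: hm cl hm')
    qed (use C in \<open>simp_all add: cl\<close>)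
  next
    case 23 note C = this
    show ?case unfolding leq_def
    proof (rule eqI[OF C(3)], goal_cases)
      case (3 M h) note hm = halmos_homD[OF 3(2)]
      interpret M: halmos_algebra \<Theta> X0 M by (fact 3(1))
      note hm' = M.sub_comp[unfolded leq_def, OF C(1)] hm(3)
      show ?case using C by (simp add: hm cl hm')
    qed (use C in \<open>simp_all add: cl\<close>)
  next
    case 24 note C = this
    show ?case unfolding leq_def
    proof (rule eqI[OF C(2)], goal_cases)
      case (3 M h) note hm = halmos_homD[OF 3(2)]
      interpret M: halmos_algebra \<Theta> X0 M by (fact 3(1))
      show ?case using M.sub_ex_agree[OF C(1-5) C(6) hm(3)[OF C(1) C(7)]] C(1-5,7) by (simp add: hm cl)
    qed (use C(1-5,7) in \<open>simp_all add: cl\<close>)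
  next
    case 25 note C = this
    show ?case unfolding leq_def
    proof (rule eqI[OF C(2)], goal_cases)
      case (3 M h) note hm = halmos_homD[OF 3(2)]
      interpret M: halmos_algebra \<Theta> X0 M by (fact 3(1))
      show ?case using M.sub_ex[OF C(1-6) C(7) hm(3)[OF C(1) C(8)]] C(1-5,8) by (simp add: hm cl)
    qed (use C(1-5,8) in \<open>simp_all add: cl\<close>)
  next
    case 26 note C = this
    show ?case unfolding leq_def
    proof (rule eqI[OF C(2)], goal_cases)
      case (3 M h) note hm = halmos_homD[OF 3(2)]
      interpret M: halmos_algebra \<Theta> X0 M by (fact 3(1))
      note hm' = M.sub_eqn[unfolded leq_def, OF C(1)] hm(3)
      show ?case using C by (simp add: hm cl hm')
    qed (use C in \<open>simp_all add: cl\<close>)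
  next
    case 27 note C = this
    show ?case unfolding leq_def
    proof (rule eqI[OF C(1)], goal_cases)
      case (3 M h) note hm = halmos_homD[OF 3(2)]
      interpret M: halmos_algebra \<Theta> X0 M by (fact 3(1))
      show ?case using M.sub_replace[OF C(1-8) C(9) hm(3)[OF C(1) C(10)]] C(1-6,10) by (simp add: hm cl leq_def)
    qed (use C(1-6,10) in \<open>simp_all add: cl\<close>)
  qed
qed

fun evl :: "('f,'v,'l) halmos \<Rightarrow> 'v set \<Rightarrow> ('f,'v) fm \<Rightarrow> 'l" where
  "evl L X (Eqn w w') = eqn L X w w'"
| "evl L X Zer = zer L X"
| "evl L X One = one L X"
| "evl L X (Neg p) = neg L X (evl L X p)"
| "evl L X (Meet p q) = meet L X (evl L X p) (evl L X q)"
| "evl L X (Join p q) = join L X (evl L X p) (evl L X q)"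
| "evl L X (Ex x p) = ex L X x (evl L X p)"
| "evl L X (Sub Y s p) = sub L Y X s (evl L Y p)"

lemma (in halmos_sig) evl_closed: "wf_fm \<Theta> X0 X p \<Longrightarrow> X \<in> sorts X0 \<Longrightarrow> evl L X p \<in> dom L X"
  by (induction rule: wf_fm.induct)
    (auto intro: zer_closed one_closed neg_closed meet_closed join_closed ex_closed eqn_closed sub_closed)

lemma word_sig: "halmos_sig \<Theta> X0 (word_alg \<Theta> X0)"
  by unfold_locales (auto simp: word_alg_def intro: wf_fm.intros)

definition ker where
  "ker \<Theta> X0 L X = {(p, q). wf_fm \<Theta> X0 X p \<and> wf_fm \<Theta> X0 X q \<and> evl L X p = evl L X q}"

lemma ker_cong: "halmos_cong \<Theta> X0 (word_alg \<Theta> X0) (ker \<Theta> X0 L)"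
  unfolding halmos_cong_def
  by (auto simp: ker_def word_alg_def equiv_def refl_on_def sym_def trans_def intro: wf_fm.intros)

lemma hcongD:
  assumes "halmos_cong \<Theta> X0 (word_alg \<Theta> X0) R" "X \<in> sorts X0"
  shows "equiv {p. wf_fm \<Theta> X0 X p} (R X)"
   "(p,p') \<in> R X \<Longrightarrow> (Neg p, Neg p') \<in> R X"
   "(p,p') \<in> R X \<Longrightarrow> (q,q') \<in> R X \<Longrightarrow> (Meet p q, Meet p' q') \<in> R X"
   "(p,p') \<in> R X \<Longrightarrow> (q,q') \<in> R X \<Longrightarrow> (Join p q, Join p' q') \<in> R X"
   "x \<in> X \<Longrightarrow> (p,p') \<in> R X \<Longrightarrow> (Ex x p, Ex x p') \<in> R X"
   "Y \<in> sorts X0 \<Longrightarrow> s \<in> Hom \<Theta> (W \<Theta> X) (W \<Theta> Y) \<Longrightarrow> (p,p') \<in> R X \<Longrightarrow> (Sub X s p, Sub X s p') \<in> R Y"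
  using bspec[OF assms(1)[unfolded halmos_cong_def word_alg_def, simplified] assms(2)] by blast+

context
  fixes \<Theta> :: "'f variety" and X0 :: "'v set" and R
  assumes R: "halmos_cong \<Theta> X0 (word_alg \<Theta> X0) R"
begin

abbreviation (input) "Q \<equiv> quot (word_alg \<Theta> X0) R"
abbreviation (input) "c X p \<equiv> R X `` {p}"

lemma c_eq: "X \<in> sorts X0 \<Longrightarrow> (p,q) \<in> R X \<Longrightarrow> c X p = c X q"
  using hcongD(1)[OF R] equiv_class_eq by metis

lemma c_self: "X \<in> sorts X0 \<Longrightarrow> wf_fm \<Theta> X0 X p \<Longrightarrow> (p, p) \<in> R X"
  using hcongD(1)[OF R] by (auto simp: equiv_def refl_on_def)

lemma wf_cD: "X \<in> sorts X0 \<Longrightarrow> (p, q) \<in> R X \<Longrightarrow> wf_fm \<Theta> X0 X p \<and> wf_fm \<Theta> X0 X q"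
  using hcongD(1)[OF R, of X] by (auto simp: equiv_def refl_on_def)

lemma Q_simps:
  "dom Q X = c X ` {p. wf_fm \<Theta> X0 X p}"
  "zer Q X = c X Zer" "one Q X = c X One" "eqn Q X w w' = c X (Eqn w w')"
  by (auto simp: quot_def word_alg_def quotient_def)

lemma Q_ops:
  assumes "X \<in> sorts X0" "wf_fm \<Theta> X0 X p" 
  shows "neg Q X (c X p) = c X (Neg p)"
    "wf_fm \<Theta> X0 X q \<Longrightarrow> meet Q X (c X p) (c X q) = c X (Meet p q)"
    "wf_fm \<Theta> X0 X q \<Longrightarrow> join Q X (c X p) (c X q) = c X (Join p q)"
    "x \<in> X \<Longrightarrow> ex Q X x (c X p) = c X (Ex x p)"
    "Y \<in> sorts X0 \<Longrightarrow> s \<in> Hom \<Theta> (W \<Theta> X) (W \<Theta> Y) \<Longrightarrow> sub Q X Y s (c X p) = c Y (Sub X s p)"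
proof -
  have 1: "(\<Union>a\<in>c X p. c Y (f a)) = c Y (f p)" if "\<And>p'. (p,p') \<in> R X \<Longrightarrow> c Y (f p) = c Y (f p')" for Y f
    using that c_self assms by blast
  have 2: "(\<Union>a\<in>c X p. \<Union>b\<in>c X q. c X (f a b)) = c X (f p q)"
    if "\<And>p' q'. (p,p') \<in> R X \<Longrightarrow> (q,q') \<in> R X \<Longrightarrow> c X (f p q) = c X (f p' q')" "wf_fm \<Theta> X0 X q" for f q
    using that c_self assms by blast
  note h = hcongD[OF R assms(1)]
  show "neg Q X (c X p) = c X (Neg p)"
    by (simp add: quot_def word_alg_def 1 c_eq h assms)
  show "wf_fm \<Theta> X0 X q \<Longrightarrow> meet Q X (c X p) (c X q) = c X (Meet p q)"
    by (simp add: quot_def word_alg_def) (intro 2 c_eq h assms)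
  show "wf_fm \<Theta> X0 X q \<Longrightarrow> join Q X (c X p) (c X q) = c X (Join p q)"
    by (simp add: quot_def word_alg_def) (intro 2 c_eq h assms)
  show "x \<in> X \<Longrightarrow> ex Q X x (c X p) = c X (Ex x p)"
    by (simp add: quot_def word_alg_def) (intro 1 c_eq h assms)
  show "Y \<in> sorts X0 \<Longrightarrow> s \<in> Hom \<Theta> (W \<Theta> X) (W \<Theta> Y) \<Longrightarrow> sub Q X Y s (c X p) = c Y (Sub X s p)"
    by (simp add: quot_def word_alg_def) (intro 1 c_eq h)
qed

lemma Q_sig: "halmos_sig \<Theta> X0 Q"
  by unfold_locales (auto simp: Q_simps Q_ops intro!: imageI wf_fm.intros)

lemma Q_hom:
  assumes "\<And>X p q. X \<in> sorts X0 \<Longrightarrow> (p,q) \<in> R X \<Longrightarrow> evl L X p = evl L X q" and "halmos_sig \<Theta> X0 L"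
  obtains h where "halmos_hom \<Theta> X0 Q L h" "\<And>X p. X \<in> sorts X0 \<Longrightarrow> wf_fm \<Theta> X0 X p \<Longrightarrow> h X (c X p) = evl L X p"
proof -
  define h where "h = (\<lambda>X\<in>sorts X0. \<lambda>a\<in>dom Q X. evl L X (SOME p. p \<in> a))"
  have h: "h X (c X p) = evl L X p" if "X \<in> sorts X0" "wf_fm \<Theta> X0 X p" for X p
  proof -
    have "(p, SOME q. q \<in> c X p) \<in> R X" using c_self[OF that] by (metis Image_singleton_iff someI)
    then show ?thesis using assms(1)[OF that(1)] that by (auto simp: h_def Q_simps)
  qed
  have "halmos_hom \<Theta> X0 Q L h"
    unfolding halmos_hom_def
  proof (intro conjI)
    show "h \<in> (\<Pi>\<^sub>E X\<in>sorts X0. dom Q X \<rightarrow>\<^sub>E dom L X)"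
    proof (intro PiE_I)
      fix X a assume "X \<in> sorts X0" "a \<in> dom Q X"
      then show "h X a \<in> dom L X" using h halmos_sig.evl_closed[OF assms(2)] by (auto simp: Q_simps)
    qed (auto simp: h_def)
  qed (auto simp: Q_simps Q_ops h wf_fm.intros)
  then show thesis using that h by blast
qed

end

lemma ker_halmos:
  fixes \<Theta> :: "'f variety" and L :: "('f, 'v, 'l) halmos"
  assumes V: "is_variety \<Theta>" and L: "halmos_algebra \<Theta> X0 L"
  shows "halmos_algebra \<Theta> X0 (quot (word_alg \<Theta> X0) (ker \<Theta> X0 L))"
proof (rule halmos_separated[where 'm='l, OF V Q_sig[OF ker_cong]])
  have S: "halmos_sig \<Theta> X0 L" using L by (simp add: halmos_algebra_def)
  obtain h where h: "halmos_hom \<Theta> X0 (quot (word_alg \<Theta> X0) (ker \<Theta> X0 L)) L h"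
    "\<And>X p. X \<in> sorts X0 \<Longrightarrow> wf_fm \<Theta> X0 X p \<Longrightarrow> h X (ker \<Theta> X0 L X `` {p}) = evl L X p"
    by (rule Q_hom[OF ker_cong _ S, of L]) (auto simp: ker_def)
  fix X a b assume a: "X \<in> sorts X0" "a \<in> dom (quot (word_alg \<Theta> X0) (ker \<Theta> X0 L)) X"
    "b \<in> dom (quot (word_alg \<Theta> X0) (ker \<Theta> X0 L)) X" "a \<noteq> b"
  then obtain p q where p: "wf_fm \<Theta> X0 X p" "wf_fm \<Theta> X0 X q" "a = ker \<Theta> X0 L X `` {p}" "b = ker \<Theta> X0 L X `` {q}"
    by (auto simp: Q_simps[OF ker_cong])
  then have "(p, q) \<notin> ker \<Theta> X0 L X" using a c_eq[OF ker_cong] by metis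
  then have "h X a \<noteq> h X b" using h a p by (auto simp: ker_def)
  then show "\<exists>(M::('f,'v,'l) halmos) h. halmos_algebra \<Theta> X0 M \<and> halmos_hom \<Theta> X0 (quot (word_alg \<Theta> X0) (ker \<Theta> X0 L)) M h \<and> h X a \<noteq> h X b"
    using h(1) L by blast
qed

lemma Phi_cong: "halmos_cong \<Theta> X0 (word_alg \<Theta> X0) (Phi_rel \<Theta> X0)"
proof -
  note h = hcongD
  have e: "halmos_cong \<Theta> X0 (word_alg \<Theta> X0) R \<Longrightarrow> X \<in> sorts X0 \<Longrightarrow> equiv {p. wf_fm \<Theta> X0 X p} (R X)" for R X
    by (rule hcongD)
  show ?thesis unfolding halmos_cong_def
  proof (intro ballI conjI)
    fix X assume X: "X \<in> sorts X0"
    show "equiv (dom (word_alg \<Theta> X0) X) (Phi_rel \<Theta> X0 X)"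
    proof (intro equivI)
      show "refl_on (dom (word_alg \<Theta> X0) X) (Phi_rel \<Theta> X0 X)"
        using c_self[OF _ X] by (auto simp: word_alg_def refl_on_def Phi_rel_def)
      show "sym (Phi_rel \<Theta> X0 X)" using e[OF _ X] unfolding sym_def Phi_rel_def equiv_def by blast
      show "trans (Phi_rel \<Theta> X0 X)" using e[OF _ X] unfolding trans_def Phi_rel_def equiv_def by blast
      show "Phi_rel \<Theta> X0 X \<subseteq> dom (word_alg \<Theta> X0) X \<times> dom (word_alg \<Theta> X0) X" by (auto simp: Phi_rel_def word_alg_def)
    qed
  qed (auto simp: Phi_rel_def word_alg_def h intro!: wf_fm.intros)
qed

lemma Phi_halmos:
  fixes \<Theta> :: "'f variety" and X0 :: "'v set"
  assumes V: "is_variety \<Theta>"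
  shows "halmos_algebra \<Theta> X0 (Phi \<Theta> X0)"
  unfolding Phi_def
proof (rule halmos_separated[where 'm="('f,'v) fm set", OF V Q_sig[OF Phi_cong]])
  fix X a b assume a: "X \<in> sorts X0" "a \<in> dom (quot (word_alg \<Theta> X0) (Phi_rel \<Theta> X0)) X"
    "b \<in> dom (quot (word_alg \<Theta> X0) (Phi_rel \<Theta> X0)) X" "a \<noteq> b"
  then obtain p q where p: "wf_fm \<Theta> X0 X p" "wf_fm \<Theta> X0 X q" "a = Phi_rel \<Theta> X0 X `` {p}" "b = Phi_rel \<Theta> X0 X `` {q}"
    by (auto simp: Q_simps[OF Phi_cong])
  then have "(p, q) \<notin> Phi_rel \<Theta> X0 X" using a c_eq[OF Phi_cong] by metis
  then obtain R where R: "halmos_cong \<Theta> X0 (word_alg \<Theta> X0) R" "halmos_algebra \<Theta> X0 (quot (word_alg \<Theta> X0) R)" "(p,q) \<notin> R X"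
    using p by (auto simp: Phi_rel_def)
  have E: "evl (quot (word_alg \<Theta> X0) R) X p = R X `` {p}" if "wf_fm \<Theta> X0 X p" "X \<in> sorts X0" for p X
    using that by (induction rule: wf_fm.induct) (auto simp: Q_simps[OF R(1)] Q_ops[OF R(1)])
  have S: "halmos_sig \<Theta> X0 (quot (word_alg \<Theta> X0) R)" using R by (simp add: halmos_algebra_def)
  have "evl (quot (word_alg \<Theta> X0) R) X p = evl (quot (word_alg \<Theta> X0) R) X q" if "X \<in> sorts X0" "(p, q) \<in> Phi_rel \<Theta> X0 X" for X p q
    using that R E c_eq[OF R(1)] by (auto simp: Phi_rel_def)
  note ev = this
  obtain h where
    h: "halmos_hom \<Theta> X0 (quot (word_alg \<Theta> X0) (Phi_rel \<Theta> X0)) (quot (word_alg \<Theta> X0) R) h"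
    "\<And>X p. X \<in> sorts X0 \<Longrightarrow> wf_fm \<Theta> X0 X p \<Longrightarrow> h X (Phi_rel \<Theta> X0 X `` {p}) = evl (quot (word_alg \<Theta> X0) R) X p"
    by (rule Q_hom[OF Phi_cong ev S]) (assumption | erule that, simp)+
  have "h X a \<noteq> h X b" using h(2)[OF a(1)] p E a(1) R(3) hcongD(1)[OF R(1) a(1)]
    by (auto dest: eq_equiv_class)
  then show "\<exists>(M::('f,'v,('f,'v) fm set) halmos) h. halmos_algebra \<Theta> X0 M \<and> halmos_hom \<Theta> X0 (quot (word_alg \<Theta> X0) (Phi_rel \<Theta> X0)) M h \<and> h X a \<noteq> h X b"
    using h(1) R(2) by blast
qed

theorem Phi_initial:
  assumes V: "is_variety \<Theta>" and L: "halmos_algebra \<Theta> X0 L"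
  shows "\<exists>!h. halmos_hom \<Theta> X0 (Phi \<Theta> X0) L h"
proof -
  have S: "halmos_sig \<Theta> X0 L" using L by (simp add: halmos_algebra_def)
  have "evl L X p = evl L X q" if "X \<in> sorts X0" "(p, q) \<in> Phi_rel \<Theta> X0 X" for X p q
  proof -
    have "(p, q) \<in> ker \<Theta> X0 L X" using that ker_cong ker_halmos[OF V L] unfolding Phi_rel_def by blast
    then show ?thesis by (simp add: ker_def)
  qed
  note ev = this
  obtain h where h: "halmos_hom \<Theta> X0 (Phi \<Theta> X0) L h" unfolding Phi_def by (rule Q_hom[OF Phi_cong ev S])
  have *: "g X (Phi_rel \<Theta> X0 X `` {p}) = evl L X p"
    if g: "halmos_hom \<Theta> X0 (Phi \<Theta> X0) L g" and "wf_fm \<Theta> X0 X p" "X \<in> sorts X0" for g X p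
    using that(2,3)
  proof (induction rule: wf_fm.induct)
    note D = halmos_homD[OF g, unfolded Phi_def] and qs = Q_simps[OF Phi_cong] and qo = Q_ops[OF Phi_cong]
    { case (1 w X w') then show ?case using D(8)[of X w w'] by (simp add: qs) }
    { case (2 X) then show ?case using D(1)[of X] by (simp add: qs) }
    { case (3 X) then show ?case using D(2)[of X] by (simp add: qs) }
    { case (4 X p) then show ?case using D(4)[of X "Phi_rel \<Theta> X0 X `` {p}"] by (simp add: qs qo) }
    { case (5 X p q) then show ?case using D(5)[of X "Phi_rel \<Theta> X0 X `` {p}" "Phi_rel \<Theta> X0 X `` {q}"] by (simp add: qs qo) }
    { case (6 X p q) then show ?case using D(6)[of X "Phi_rel \<Theta> X0 X `` {p}" "Phi_rel \<Theta> X0 X `` {q}"] by (simp add: qs qo) }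
    { case (7 x X p) then show ?case using D(7)[of X x "Phi_rel \<Theta> X0 X `` {p}"] by (simp add: qs qo) }
    { case (8 X s Y p) then show ?case using D(9)[of X Y s "Phi_rel \<Theta> X0 X `` {p}"] by (simp add: qs qo) }
  qed
  have "g = h" if g: "halmos_hom \<Theta> X0 (Phi \<Theta> X0) L g" for g
  proof (rule PiE_ext[of g "sorts X0" "\<lambda>X. dom (Phi \<Theta> X0) X \<rightarrow>\<^sub>E dom L X"])
    show gh: "g \<in> (\<Pi>\<^sub>E X\<in>sorts X0. dom (Phi \<Theta> X0) X \<rightarrow>\<^sub>E dom L X)"
      "h \<in> (\<Pi>\<^sub>E X\<in>sorts X0. dom (Phi \<Theta> X0) X \<rightarrow>\<^sub>E dom L X)"
      using g h by (simp_all add: halmos_hom_def)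
    fix X assume X: "X \<in> sorts X0"
    show "g X = h X"
    proof (rule PiE_ext[of _ "dom (Phi \<Theta> X0) X" "\<lambda>_. dom L X"])
      fix a assume "a \<in> dom (Phi \<Theta> X0) X"
      then show "g X a = h X a" using *[OF g] *[OF h] X by (auto simp: Phi_def Q_simps[OF Phi_cong])
    qed (use PiE_mem[OF gh(1) X] PiE_mem[OF gh(2) X] in simp_all)
  qed
  then show ?thesis using h by blast
qed

theorem Val_hom:
  assumes "is_variety \<Theta>" "in_variety \<Theta> H"
  shows "halmos_hom \<Theta> X0 (Phi \<Theta> X0) (Hal \<Theta> H) (Val \<Theta> X0 H)"
  unfolding Val_def by (rule theI'[OF Phi_initial[OF assms(1) halmos_Hal[OF assms]]])

end

theory Submission
  imports Defs
begin

text \<open>The truth of a first-order formula at a point \<open>\<eta> : W(X\<^sup>0) \<rightarrow> H\<close> depends only on the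
  values of \<open>\<eta>\<close> at the free variables. If \<open>s\<close> is special, then \<open>\<mu> \<circ> s\<close> agrees with \<open>\<mu>\<close> on
  \<open>X\<close>, so an \<open>X\<close>-special formula holds at every extension of \<open>\<mu>\<close> from \<open>X\<close> to \<open>X\<^sup>0\<close> iff it
  holds at the one extension \<open>\<mu> \<circ> s\<close>, which says that \<open>\<mu>\<close> satisfies \<open>s\<^sub>*u\<close>. The point
  \<open>\<mu> \<circ> s\<close> also shows that an extension of \<open>\<mu>\<close> exists.\<close>

lemma wf_fo_word: "wf_fo (sgn \<Theta>) X0 p \<Longrightarrow> wf_fm \<Theta> X0 X0 (fo_word \<Theta> X0 p)"
  by (induction p) (auto simp: univ_W intro: wf_fm.intros)

lemma sort_top: "X0 \<in> sorts X0"
  by (simp add: sorts_def)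

lemma fo_class_Phi: "wf_fo (sgn \<Theta>) X0 p \<Longrightarrow> fo_class \<Theta> X0 p \<in> dom (Phi \<Theta> X0) X0"
  by (simp add: fo_class_def Phi_def Q_simps[OF Phi_cong] wf_fo_word)

text \<open>Since \<open>Phi_rel\<close> is a congruence, the class of a word is obtained by the
  operations of \<open>Phi\<close> from the classes of its subwords. In this form the homomorphism
  laws of \<open>Val\<close> can be applied to formulas.\<close>

lemma fo_class_simps:
  "fo_class \<Theta> X0 (FEq t u) = eqn (Phi \<Theta> X0) X0 (cls \<Theta> X0 t) (cls \<Theta> X0 u)"
  "fo_class \<Theta> X0 FFalse = zer (Phi \<Theta> X0) X0"
  "fo_class \<Theta> X0 FTrue = one (Phi \<Theta> X0) X0"
  "wf_fo (sgn \<Theta>) X0 p \<Longrightarrow> fo_class \<Theta> X0 (FNeg p) = neg (Phi \<Theta> X0) X0 (fo_class \<Theta> X0 p)"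
  "wf_fo (sgn \<Theta>) X0 p \<Longrightarrow> wf_fo (sgn \<Theta>) X0 q \<Longrightarrow>
    fo_class \<Theta> X0 (FAnd p q) = meet (Phi \<Theta> X0) X0 (fo_class \<Theta> X0 p) (fo_class \<Theta> X0 q)"
  "wf_fo (sgn \<Theta>) X0 p \<Longrightarrow> wf_fo (sgn \<Theta>) X0 q \<Longrightarrow>
    fo_class \<Theta> X0 (FOr p q) = join (Phi \<Theta> X0) X0 (fo_class \<Theta> X0 p) (fo_class \<Theta> X0 q)"
  "wf_fo (sgn \<Theta>) X0 p \<Longrightarrow> x \<in> X0 \<Longrightarrow>
    fo_class \<Theta> X0 (FEx x p) = ex (Phi \<Theta> X0) X0 x (fo_class \<Theta> X0 p)"
  by (simp_all add: fo_class_def Phi_def Q_simps[OF Phi_cong] Q_ops[OF Phi_cong] wf_fo_word sort_top)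

context
  fixes \<Theta> :: "'f variety" and X0 :: "'v set" and H :: "('f, 'h) alg"
  assumes V: "is_variety \<Theta>" and H: "in_variety \<Theta> H"
begin

text \<open>\<open>Val\<close> is a homomorphism into \<open>Hal\<close>, whose operations are the
  set-theoretic ones, so Tarski's truth clauses come out. They allow induction on the formula, where
  free variables live, instead of on its class.\<close>

lemma Val_fo_class:
  "t \<in> terms (sgn \<Theta>) X0 \<Longrightarrow> u \<in> terms (sgn \<Theta>) X0 \<Longrightarrow>
    Val \<Theta> X0 H X0 (fo_class \<Theta> X0 (FEq t u)) =
      {\<eta> \<in> Hom \<Theta> (W \<Theta> X0) H. \<eta> (cls \<Theta> X0 t) = \<eta> (cls \<Theta> X0 u)}"
  "Val \<Theta> X0 H X0 (fo_class \<Theta> X0 FFalse) = {}"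
  "Val \<Theta> X0 H X0 (fo_class \<Theta> X0 FTrue) = Hom \<Theta> (W \<Theta> X0) H"
  "wf_fo (sgn \<Theta>) X0 p \<Longrightarrow>
    Val \<Theta> X0 H X0 (fo_class \<Theta> X0 (FNeg p)) =
      Hom \<Theta> (W \<Theta> X0) H - Val \<Theta> X0 H X0 (fo_class \<Theta> X0 p)"
  "wf_fo (sgn \<Theta>) X0 p \<Longrightarrow> wf_fo (sgn \<Theta>) X0 q \<Longrightarrow>
    Val \<Theta> X0 H X0 (fo_class \<Theta> X0 (FAnd p q)) =
      Val \<Theta> X0 H X0 (fo_class \<Theta> X0 p) \<inter> Val \<Theta> X0 H X0 (fo_class \<Theta> X0 q)"
  "wf_fo (sgn \<Theta>) X0 p \<Longrightarrow> wf_fo (sgn \<Theta>) X0 q \<Longrightarrow>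
    Val \<Theta> X0 H X0 (fo_class \<Theta> X0 (FOr p q)) =
      Val \<Theta> X0 H X0 (fo_class \<Theta> X0 p) \<union> Val \<Theta> X0 H X0 (fo_class \<Theta> X0 q)"
  "wf_fo (sgn \<Theta>) X0 p \<Longrightarrow> x \<in> X0 \<Longrightarrow>
    Val \<Theta> X0 H X0 (fo_class \<Theta> X0 (FEx x p)) =
      {\<eta> \<in> Hom \<Theta> (W \<Theta> X0) H. \<exists>\<nu>\<in>Val \<Theta> X0 H X0 (fo_class \<Theta> X0 p).
        \<forall>y\<in>X0. y \<noteq> x \<longrightarrow> \<nu> (var \<Theta> X0 y) = \<eta> (var \<Theta> X0 y)}"
  by (simp_all add: fo_class_simps halmos_homD[OF Val_hom[OF V H]] sort_top fo_class_Phi univ_W)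
    (simp_all add: Hal_def)

lemma Val_fo_class_subset:
  assumes "wf_fo (sgn \<Theta>) X0 p"
  shows "Val \<Theta> X0 H X0 (fo_class \<Theta> X0 p) \<subseteq> Hom \<Theta> (W \<Theta> X0) H"
  using halmos_homD(3)[OF Val_hom[OF V H] sort_top fo_class_Phi[OF assms]] by (simp add: Hal_def)

text \<open>One implication suffices because the assumptions on the two points are symmetric. Both
  points are generalised in the induction: negation exchanges them and the quantifier replaces
  them.\<close>

lemma Val_fo_class_agree:
  assumes "wf_fo (sgn \<Theta>) X0 p"
    and "\<eta> \<in> Hom \<Theta> (W \<Theta> X0) H" "\<eta>' \<in> Hom \<Theta> (W \<Theta> X0) H"
    and "\<And>x. x \<in> free_vars p \<Longrightarrow> \<eta> (var \<Theta> X0 x) = \<eta>' (var \<Theta> X0 x)"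
    and "\<eta> \<in> Val \<Theta> X0 H X0 (fo_class \<Theta> X0 p)"
  shows "\<eta>' \<in> Val \<Theta> X0 H X0 (fo_class \<Theta> X0 p)"
  using assms
proof (induction p arbitrary: \<eta> \<eta>')
  case (FEq t u)
  have "\<eta> (cls \<Theta> X0 r) = \<eta>' (cls \<Theta> X0 r)" if "r \<in> {t, u}" for r
    using FEq.prems that by (auto simp: Hom_ev[OF V] intro!: ev_agree)
  then show ?case using FEq.prems by (auto simp: Val_fo_class)
next
  case (FNeg p)
  \<comment> \<open>Induction hypothesis with the two points exchanged; its contrapositive is the
    negated case.\<close>
  have "\<eta> \<in> Val \<Theta> X0 H X0 (fo_class \<Theta> X0 p)" if "\<eta>' \<in> Val \<Theta> X0 H X0 (fo_class \<Theta> X0 p)"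
    by (rule FNeg.IH[OF _ FNeg.prems(3,2) _ that]) (use FNeg.prems(1,4) in simp_all)
  then show ?case using FNeg.prems(1,3,5) by (auto simp: Val_fo_class)
next
  case (FAnd p q)
  have "\<eta>' \<in> Val \<Theta> X0 H X0 (fo_class \<Theta> X0 r)"
    if "r \<in> {p, q}" "\<eta> \<in> Val \<Theta> X0 H X0 (fo_class \<Theta> X0 r)" for r
    using that FAnd.IH[OF _ FAnd.prems(2,3)] FAnd.prems(1,4) by auto
  then show ?case using FAnd.prems(1,5) by (auto simp: Val_fo_class)
next
  case (FOr p q)
  have "\<eta>' \<in> Val \<Theta> X0 H X0 (fo_class \<Theta> X0 r)"
    if "r \<in> {p, q}" "\<eta> \<in> Val \<Theta> X0 H X0 (fo_class \<Theta> X0 r)" for r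
    using that FOr.IH[OF _ FOr.prems(2,3)] FOr.prems(1,4) by auto
  then show ?case using FOr.prems(1,5) by (auto simp: Val_fo_class)
next
  case (FEx x p)
  have p: "wf_fo (sgn \<Theta>) X0 p" "x \<in> X0" using FEx.prems by auto
  obtain \<nu> where \<nu>: "\<nu> \<in> Val \<Theta> X0 H X0 (fo_class \<Theta> X0 p)"
      "\<And>y. y \<in> X0 \<Longrightarrow> y \<noteq> x \<Longrightarrow> \<nu> (var \<Theta> X0 y) = \<eta> (var \<Theta> X0 y)"
    using FEx.prems(5) p by (auto simp: Val_fo_class)
  have \<nu>H: "\<nu> \<in> Hom \<Theta> (W \<Theta> X0) H" using \<nu>(1) Val_fo_class_subset[OF p(1)] by auto
  \<comment> \<open>The witness \<nu> is a variant of \<eta>, whereas a variant of \<eta>' is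
    needed: keep the value of \<nu> at \<open>x\<close> and take \<eta>' elsewhere.\<close>
  define \<alpha> where "\<alpha> = (\<lambda>y. if y = x then \<nu> (var \<Theta> X0 x) else \<eta>' (var \<Theta> X0 y))"
  have "\<alpha> y \<in> univ H" if "y \<in> X0" for y
    using that Hom_funD[OF \<nu>H] Hom_funD[OF FEx.prems(3)] by (auto simp: \<alpha>_def var_W)
  then obtain \<nu>' where \<nu>': "\<nu>' \<in> Hom \<Theta> (W \<Theta> X0) H" "\<And>y. y \<in> X0 \<Longrightarrow> \<nu>' (var \<Theta> X0 y) = \<alpha> y"
    using Hom_extend[OF V H, where X=X0 and \<alpha>=\<alpha>] by blast
  \<comment> \<open>Both \<nu> and \<nu>' are controlled only at variables in
    \<open>X0\<close>.\<close>
  have free: "free_vars q \<subseteq> X0" if "wf_fo (sgn \<Theta>) X0 q" for q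
    using that by (induction q) (auto dest: terms_tvars)
  have "\<nu> (var \<Theta> X0 y) = \<nu>' (var \<Theta> X0 y)" if "y \<in> free_vars p" for y
    using that free[OF p(1)] FEx.prems(4)[of y] \<nu>(2)[of y] \<nu>'(2)[of y] by (auto simp: \<alpha>_def)
  then have "\<nu>' \<in> Val \<Theta> X0 H X0 (fo_class \<Theta> X0 p)"
    using FEx.IH[OF p(1) \<nu>H \<nu>'(1) _ \<nu>(1)] by blast
  moreover have "\<forall>y\<in>X0. y \<noteq> x \<longrightarrow> \<nu>' (var \<Theta> X0 y) = \<eta>' (var \<Theta> X0 y)"
    using \<nu>'(2) by (simp add: \<alpha>_def)
  ultimately show ?case using FEx.prems(3) unfolding Val_fo_class(7)[OF p] by blast
qed (simp_all add: Val_fo_class)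

text \<open>\<open>Val\<close> commutes with the maps \<open>sub\<close>, and in \<open>Hal\<close>
  such a map is the preimage under precomposition with \<open>s\<close>.\<close>

lemma LKer_sub_iff:
  assumes "X \<in> sorts X0" "Y \<in> sorts X0" "s \<in> Hom \<Theta> (W \<Theta> X) (W \<Theta> Y)"
    and "u \<in> dom (Phi \<Theta> X0) X" "\<mu> \<in> Hom \<Theta> (W \<Theta> Y) H"
  shows "sub (Phi \<Theta> X0) X Y s u \<in> LKer \<Theta> X0 H Y \<mu> \<longleftrightarrow>
    compose (univ (W \<Theta> X)) \<mu> s \<in> Val \<Theta> X0 H X u"
proof -
  have "sub (Phi \<Theta> X0) X Y s u \<in> dom (Phi \<Theta> X0) Y"
    using assms Phi_halmos[OF V] by (intro halmos_sig.sub_closed) (auto simp: halmos_algebra_def)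
  then show ?thesis
    using assms halmos_homD(9)[OF Val_hom[OF V H] assms(1-4)] by (simp add: LKer_def Hal_def)
qed

lemma Tp_iff_compose:
  assumes "X \<subseteq> X0" "special_hom \<Theta> X0 X s" "\<mu> \<in> Hom \<Theta> (W \<Theta> X) H" "X_special \<Theta> X0 X u"
  shows "u \<in> Tp \<Theta> X0 H X \<mu> \<longleftrightarrow> compose (univ (W \<Theta> X0)) \<mu> s \<in> Val \<Theta> X0 H X0 u"
proof -
  let ?\<eta> = "compose (univ (W \<Theta> X0)) \<mu> s"
  have s: "s \<in> Hom \<Theta> (W \<Theta> X0) (W \<Theta> X)" "\<And>x. x \<in> X \<Longrightarrow> s (var \<Theta> X0 x) = var \<Theta> X x"
    using assms(2) by (auto simp: special_hom_def)
  have \<eta>: "?\<eta> \<in> Hom \<Theta> (W \<Theta> X0) H" by (rule Hom_compose[OF W_is_alg[OF V] s(1) assms(3)])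
  have \<eta>X: "?\<eta> (var \<Theta> X0 x) = \<mu> (var \<Theta> X x)" if "x \<in> X" for x
    using that assms(1) s(2) var_W[of x X0 \<Theta>] by (auto simp: compose_def)
  obtain p where p: "wf_fo (sgn \<Theta>) X0 p" "u = fo_class \<Theta> X0 p" "free_vars p \<subseteq> X"
    using assms(4) by (auto simp: X_special_def)
  have "\<eta>' \<in> Val \<Theta> X0 H X0 u"
    if "?\<eta> \<in> Val \<Theta> X0 H X0 u" "\<eta>' \<in> Hom \<Theta> (W \<Theta> X0) H"
      "\<forall>x\<in>X. \<eta>' (var \<Theta> X0 x) = \<mu> (var \<Theta> X x)" for \<eta>'
    unfolding p(2)
    by (rule Val_fo_class_agree[OF p(1) \<eta> that(2)]) (use that p \<eta>X in auto)
  then show ?thesis using assms(4) \<eta> \<eta>X unfolding Tp_def by blast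
qed

end

theorem theorem4p11:
  fixes \<Theta> :: "'f variety" and X0 X :: "'v set" and H :: "('f, 'h) alg"
    and s :: "('f, 'v) wd \<Rightarrow> ('f, 'v) wd" and T :: "('f, 'v) fm set set"
  assumes "is_variety \<Theta>" and "infinite X0" and "in_variety \<Theta> H"
    and "finite X" and "X \<subseteq> X0"
    and "special_hom \<Theta> X0 X s"
    and "X_type \<Theta> X0 H X T"
  shows "L0_closure \<Theta> X0 H X T = L_closure \<Theta> X0 H X (sub (Phi \<Theta> X0) X0 X s ` T)"
proof -
  have X: "X \<in> sorts X0" using assms(4,5) by (simp add: sorts_def)
  have s: "s \<in> Hom \<Theta> (W \<Theta> X0) (W \<Theta> X)" using assms(6) by (simp add: special_hom_def)
  have "u \<in> Tp \<Theta> X0 H X \<mu> \<longleftrightarrow> sub (Phi \<Theta> X0) X0 X s u \<in> LKer \<Theta> X0 H X \<mu>"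
    if "\<mu> \<in> Hom \<Theta> (W \<Theta> X) H" "u \<in> T" for \<mu> u
  proof -
    have u: "X_special \<Theta> X0 X u" using assms(7) that(2) by (simp add: X_type_def)
    then have "u \<in> dom (Phi \<Theta> X0) X0" by (auto simp: X_special_def fo_class_Phi)
    then show ?thesis
      using Tp_iff_compose[OF assms(1,3,5,6) that(1) u]
        LKer_sub_iff[OF assms(1,3) sort_top X s _ that(1)] by blast
  qed
  then show ?thesis unfolding L0_closure_def L_closure_def by blast
qed

end
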